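(* Given a string $x$ of length $n$ over an integer alphabet and a positive integer $m<n$, the \textsc{1-mappability} problem for $x$ and $m$ can be solved in $\mathcal{O}(mn)$ time and $\mathcal{O}(n)$ space.
   Context: For strings $y,z$ of equal length, the Hamming distance $d_H(y,z)$ is the number of positions at which they differ. For a string $x=x[0]x[1]\cdots x[n-1]$, $x[i\,..\,j]=x[i]\cdots x[j]$ denotes a factor. An integer alphabet means the letters of $x$ are integers in $\{1,\ldots,n\}$. The \textsc{1-mappability} problem: given a string $x$ of length $n$ and an integer $m$ with $1\le m<n$, output an integer array $C$ of size $n-m+1$ such that, for each $0\le i\le n-m$, $C[i]$ is the number of length-$m$ factors of $x$ (counted by starting position $j\in\{0,\ldots,n-m\}$) that are at Hamming distance exactly $1$ from $x[i\,..\,i+m-1]$. The model of computation is the standard word RAM. *)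

theory Defs
  imports Main
begin

section \<open>The 1-mappability problem\<close>

definition hamming_dist :: "'a list \<Rightarrow> 'a list \<Rightarrow> nat" where
  "hamming_dist y z = card {k. k < length y \<and> y ! k \<noteq> z ! k}"

text \<open>Both ends of a factor \<open>x[i..j]\<close> are inclusive.\<close>

definition factor :: "'a list \<Rightarrow> nat \<Rightarrow> nat \<Rightarrow> 'a list" where
  "factor x i j = map ((!) x) [i..<Suc j]"

definition one_mappability :: "'a list \<Rightarrow> nat \<Rightarrow> nat list" where
  "one_mappability x m =
     map (\<lambda>i. card {j \<in> {0..length x - m}.
                 hamming_dist (factor x i (i + m - 1)) (factor x j (j + m - 1)) = 1})
       [0..<length x - m + 1]"


section \<open>The word RAM\<close>

text \<open>
  A unit-cost random access machine with words of \<open>w\<close> bits, represented by the natural numbers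
  below \<open>2 ^ w\<close>.  Operands of instructions are indices of registers; a program mentions only
  finitely many of them, so registers contribute a constant amount to the space.  The memory is
  separate and only accessible through \<open>Load\<close> and \<open>Store\<close>, whose address is in a register.
\<close>

datatype alu_op = Add | Sub | Mul | Div | Mod | BitAnd | BitOr | BitXor | ShiftL | ShiftR

datatype instr =
    Const nat nat            \<comment> \<open>\<open>Const d k\<close>: \<open>d := k\<close>\<close>
  | Move nat nat             \<comment> \<open>\<open>Move d a\<close>: \<open>d := a\<close>\<close>
  | Alu alu_op nat nat nat   \<comment> \<open>\<open>Alu f d a b\<close>: \<open>d := f a b\<close>\<close>
  | Load nat nat             \<comment> \<open>\<open>Load d a\<close>: \<open>d := mem[a]\<close>\<close>
  | Store nat nat            \<comment> \<open>\<open>Store a b\<close>: \<open>mem[a] := b\<close>\<close>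
  | Jump nat                 \<comment> \<open>\<open>Jump l\<close>: continue at position \<open>l\<close> of the program\<close>
  | JumpEq nat nat nat       \<comment> \<open>\<open>JumpEq a b l\<close>: jump to \<open>l\<close> if \<open>a = b\<close>\<close>
  | JumpLess nat nat nat     \<comment> \<open>\<open>JumpLess a b l\<close>: jump to \<open>l\<close> if \<open>a < b\<close>\<close>
  | Halt

type_synonym program = "instr list"

record config =
  pc :: nat
  reg :: "nat \<Rightarrow> nat"
  mem :: "nat \<Rightarrow> nat"

text \<open>Arithmetic is modulo \<open>2 ^ w\<close>; division by zero follows the HOL convention.\<close>

fun alu :: "nat \<Rightarrow> alu_op \<Rightarrow> nat \<Rightarrow> nat \<Rightarrow> nat" where
  "alu w Add a b = (a + b) mod 2 ^ w"
| "alu w Sub a b = (a + (2 ^ w - b)) mod 2 ^ w"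
| "alu w Mul a b = (a * b) mod 2 ^ w"
| "alu w Div a b = (a div b) mod 2 ^ w"
| "alu w Mod a b = (a mod b) mod 2 ^ w"
| "alu w BitAnd a b = semiring_bit_operations_class.and a b mod 2 ^ w"
| "alu w BitOr a b = semiring_bit_operations_class.or a b mod 2 ^ w"
| "alu w BitXor a b = semiring_bit_operations_class.xor a b mod 2 ^ w"
| "alu w ShiftL a b = push_bit b a mod 2 ^ w"
| "alu w ShiftR a b = drop_bit b a mod 2 ^ w"

fun exec_instr :: "nat \<Rightarrow> instr \<Rightarrow> config \<Rightarrow> config" where
  "exec_instr w (Const d k) s = s\<lparr>pc := pc s + 1, reg := (reg s)(d := k mod 2 ^ w)\<rparr>"
| "exec_instr w (Move d a) s = s\<lparr>pc := pc s + 1, reg := (reg s)(d := reg s a)\<rparr>"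
| "exec_instr w (Alu f d a b) s =
     s\<lparr>pc := pc s + 1, reg := (reg s)(d := alu w f (reg s a) (reg s b))\<rparr>"
| "exec_instr w (Load d a) s = s\<lparr>pc := pc s + 1, reg := (reg s)(d := mem s (reg s a))\<rparr>"
| "exec_instr w (Store a b) s = s\<lparr>pc := pc s + 1, mem := (mem s)(reg s a := reg s b)\<rparr>"
| "exec_instr w (Jump l) s = s\<lparr>pc := l\<rparr>"
| "exec_instr w (JumpEq a b l) s = s\<lparr>pc := if reg s a = reg s b then l else pc s + 1\<rparr>"
| "exec_instr w (JumpLess a b l) s = s\<lparr>pc := if reg s a < reg s b then l else pc s + 1\<rparr>"
| "exec_instr w Halt s = s"

definition halted :: "program \<Rightarrow> config \<Rightarrow> bool" where
  "halted P s \<longleftrightarrow> pc s \<ge> length P \<or> P ! pc s = Halt"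

definition step :: "nat \<Rightarrow> program \<Rightarrow> config \<Rightarrow> config" where
  "step w P s = (if halted P s then s else exec_instr w (P ! pc s) s)"

fun instr_addresses :: "instr \<Rightarrow> config \<Rightarrow> nat set" where
  "instr_addresses (Load d a) s = {reg s a}"
| "instr_addresses (Store a b) s = {reg s a}"
| "instr_addresses _ s = {}"

definition step_addresses :: "program \<Rightarrow> config \<Rightarrow> nat set" where
  "step_addresses P s = (if halted P s then {} else instr_addresses (P ! pc s) s)"

text \<open>
  \<open>P\<close> halts after at most \<open>t\<close> instructions, accesses only the memory cells \<open>0, \<dots>, b - 1\<close>
  on the way, and the final configuration satisfies \<open>Q\<close>.
\<close>

definition computes_within ::
    "nat \<Rightarrow> program \<Rightarrow> config \<Rightarrow> nat \<Rightarrow> nat \<Rightarrow> (config \<Rightarrow> bool) \<Rightarrow> bool" where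
  "computes_within w P s t b Q \<longleftrightarrow>
     (\<exists>k\<le>t. halted P ((step w P ^^ k) s) \<and>
            (\<forall>j<k. step_addresses P ((step w P ^^ j) s) \<subseteq> {..<b}) \<and>
            Q ((step w P ^^ k) s))"


section \<open>Input and output conventions\<close>

text \<open>
  Initially the cells \<open>0, \<dots>, n - 1\<close> hold the letters of \<open>x\<close>, register 0 holds \<open>n\<close> and
  register 1 holds \<open>m\<close>; everything else is 0.  The output array is expected in the cells
  \<open>n, n + 1, \<dots>\<close> directly behind the input.  One fixed program has to serve all inputs and
  all word sizes \<open>w \<ge> log n + O(1)\<close>, the latter expressed as \<open>cw * n < 2 ^ w\<close> for a constant
  \<open>cw > 0\<close>; for \<open>w\<close> any smaller, the linearly many cells could not be addressed.
\<close>

definition input_config :: "nat list \<Rightarrow> nat \<Rightarrow> config" where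
  "input_config x m =
     \<lparr>pc = 0,
      reg = (\<lambda>_. 0)(0 := length x, 1 := m),
      mem = (\<lambda>a. if a < length x then x ! a else 0)\<rparr>"

definition output_array :: "nat \<Rightarrow> nat list \<Rightarrow> config \<Rightarrow> bool" where
  "output_array n C s \<longleftrightarrow> (\<forall>i<length C. mem s (n + i) = C ! i)"

end

theory Submission
  imports Defs
begin

text \<open>
  Two factors are at Hamming distance 1 iff for exactly one offset \<open>k\<close> they agree below \<open>k\<close> and
  above \<open>k\<close> but not at \<open>k\<close>.  So the answer at \<open>i\<close> is the sum over all \<open>k\<close> of the number of
  positions that agree with \<open>i\<close> except possibly at \<open>k\<close>, minus the number of those that agree
  everywhere.

  Partitions of the positions are stored as arrays that map each position to the least one in
  its class; the common refinement of two partitions, with its class sizes, is computed in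
  linear time by bucketing.  The partitions by the first \<open>k\<close> letters are computed for
  increasing \<open>k\<close>, recording when each position became the least one of its class and which
  position was the least one before.  This makes it possible to undo the refinements for
  decreasing \<open>k\<close>, while the partitions by the letters after offset \<open>k\<close> are built up.  Each of
  the \<open>2 m\<close> rounds takes linear time, and only the current partitions are kept.
\<close>


section \<open>A small array language\<close>

text \<open>Storing the prefix partitions of all lengths would take about \<open>m * n\<close>
  cells. They form a chain of refinements, and a position that is once the least of its class
  remains so. Each position therefore becomes a representative at most once, and one time stamp and
  one former representative per position hold the whole history. Bucketing needs neither hashing nor
  sorting, because representatives and letters reduced by one are all below \<open>n\<close> and can
  index an array of \<open>n\<close> cells. Clearing such an array for every class could take
  quadratic time per round, so entries are verified when they are read. The algorithm is written
  with structured control and true arithmetic on naturals, so that jumps, address layout and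
  wrap-around are dealt with once, in \<open>comp_correct\<close>. It uses thirteen arrays of
  \<open>n\<close> cells; hence the constant 13 both for the space and for the word size, where it
  keeps addresses from wrapping around.\<close>

datatype basic =
    Assign nat nat
  | Copy nat nat
  | Plus nat nat nat
  | Minus nat nat nat
  | Get nat nat nat
  | Put nat nat nat

datatype cond = Equal nat nat | Less nat nat

datatype com =
    Skip
  | Basic basic
  | Seq com com (infixr "\<Zsemi>" 60)
  | If cond com com
  | While cond com

type_synonym state = "(nat \<Rightarrow> nat) \<times> (nat \<Rightarrow> nat \<Rightarrow> nat)"

fun holds :: "cond \<Rightarrow> state \<Rightarrow> bool" where
  "holds (Equal x y) (v, a) \<longleftrightarrow> v x = v y"
| "holds (Less x y) (v, a) \<longleftrightarrow> v x < v y"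

fun basic_exec :: "basic \<Rightarrow> state \<Rightarrow> state" where
  "basic_exec (Assign x k) (v, a) = (v(x := k), a)"
| "basic_exec (Copy x y) (v, a) = (v(x := v y), a)"
| "basic_exec (Plus x y z) (v, a) = (v(x := v y + v z), a)"
| "basic_exec (Minus x y z) (v, a) = (v(x := v y - v z), a)"
| "basic_exec (Get x A y) (v, a) = (v(x := a A (v y)), a)"
| "basic_exec (Put A y x) (v, a) = (v, a(A := (a A)(v y := v x)))"

text \<open>There are \<open>K\<close> arrays with \<open>n\<close> cells each, and \<open>M\<close> bounds the intermediate results.\<close>

locale array_machine =
  fixes n K M :: nat
begin

fun basic_safe :: "basic \<Rightarrow> state \<Rightarrow> bool" where
  "basic_safe (Assign x k) (v, a) \<longleftrightarrow> k < M"
| "basic_safe (Copy x y) (v, a) \<longleftrightarrow> True"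
| "basic_safe (Plus x y z) (v, a) \<longleftrightarrow> v y + v z < M"
| "basic_safe (Minus x y z) (v, a) \<longleftrightarrow> v z \<le> v y \<and> v y < M"
| "basic_safe (Get x A y) (v, a) \<longleftrightarrow> A < K \<and> v y < n"
| "basic_safe (Put A y x) (v, a) \<longleftrightarrow> A < K \<and> v y < n"

text \<open>The charged time bounds that of the compiled code: an array access takes two
  instructions, a failing loop test takes a conditional jump and an exit jump, and an iteration also
  pays for the jump back. Unsafe commands have no derivation, so a derivation certifies that nothing
  overflows and no index is out of range.\<close>

inductive big :: "com \<Rightarrow> state \<Rightarrow> nat \<Rightarrow> state \<Rightarrow> bool" where
  Skip: "big Skip s 0 s"
| Basic: "basic_safe b s \<Longrightarrow> big (Basic b) s 2 (basic_exec b s)"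
| Seq: "big c s t s' \<Longrightarrow> big d s' u s'' \<Longrightarrow> big (c \<Zsemi> d) s (t + u) s''"
| IfTrue: "holds e s \<Longrightarrow> big c s t s' \<Longrightarrow> big (If e c d) s (t + 2) s'"
| IfFalse: "\<not> holds e s \<Longrightarrow> big d s t s' \<Longrightarrow> big (If e c d) s (t + 2) s'"
| WhileFalse: "\<not> holds e s \<Longrightarrow> big (While e c) s 2 s"
| WhileTrue: "holds e s \<Longrightarrow> big c s t s' \<Longrightarrow> big (While e c) s' u s'' \<Longrightarrow>
    big (While e c) s (t + 2 + u) s''"

end


section \<open>Compilation to the word RAM\<close>

text \<open>Variable \<open>x\<close> lives in register \<open>2 * x\<close>, the base address of array \<open>A\<close> in register
  \<open>2 * A + 3\<close>, and register 1 is free for address computations.\<close>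

fun comp_basic :: "basic \<Rightarrow> instr list" where
  "comp_basic (Assign x k) = [Const (2 * x) k]"
| "comp_basic (Copy x y) = [Move (2 * x) (2 * y)]"
| "comp_basic (Plus x y z) = [Alu Add (2 * x) (2 * y) (2 * z)]"
| "comp_basic (Minus x y z) = [Alu Sub (2 * x) (2 * y) (2 * z)]"
| "comp_basic (Get x A y) = [Alu Add 1 (2 * A + 3) (2 * y), Load (2 * x) 1]"
| "comp_basic (Put A y x) = [Alu Add 1 (2 * A + 3) (2 * y), Store 1 (2 * x)]"

fun comp_cond :: "cond \<Rightarrow> nat \<Rightarrow> instr" where
  "comp_cond (Equal x y) l = JumpEq (2 * x) (2 * y) l"
| "comp_cond (Less x y) l = JumpLess (2 * x) (2 * y) l"

fun len :: "com \<Rightarrow> nat" where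
  "len Skip = 0"
| "len (Basic b) = length (comp_basic b)"
| "len (c \<Zsemi> d) = len c + len d"
| "len (If e c d) = len c + len d + 2"
| "len (While e c) = len c + 3"

text \<open>Jumps are absolute, so \<open>p\<close> is the address of the first instruction. A
  conditional jump is taken when its condition holds; hence the else branch precedes the then
  branch, and a successful loop test jumps over the exit jump.\<close>

fun comp :: "nat \<Rightarrow> com \<Rightarrow> instr list" where
  "comp p Skip = []"
| "comp p (Basic b) = comp_basic b"
| "comp p (c \<Zsemi> d) = comp p c @ comp (p + len c) d"
| "comp p (If e c d) = comp_cond e (p + len d + 2) # comp (p + 1) d @
     Jump (p + len d + 2 + len c) # comp (p + len d + 2) c"
| "comp p (While e c) = comp_cond e (p + 2) # Jump (p + len c + 3) # comp (p + 2) c @ [Jump p]"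

lemma length_comp [simp]: "length (comp p c) = len c"
  by (induction c arbitrary: p) auto

section \<open>Code fragments and finite runs\<close>

definition code_at :: "program \<Rightarrow> nat \<Rightarrow> instr list \<Rightarrow> bool" where
  "code_at P p I \<longleftrightarrow> (\<exists>Q R. P = Q @ I @ R \<and> length Q = p)"

lemma code_at_append: "code_at P p (I @ J) \<longleftrightarrow> code_at P p I \<and> code_at P (p + length I) J"
proof
  assume "code_at P p I \<and> code_at P (p + length I) J"
  then obtain Q R Q' R' where 1: "P = Q @ I @ R" "length Q = p"
    and 2: "P = Q' @ J @ R'" "length Q' = p + length I"
    unfolding code_at_def by blast
  have "(Q @ I) @ R = Q' @ J @ R'" "length (Q @ I) = length Q'"
    using 1 2 by simp_all
  then have "R = J @ R'" by (metis append_eq_append_conv)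
  then show "code_at P p (I @ J)" using 1 by (auto simp: code_at_def)
next
  assume "code_at P p (I @ J)"
  then show "code_at P p I \<and> code_at P (p + length I) J"
    unfolding code_at_def by (metis append.assoc length_append)
qed

lemma code_at_Cons: "code_at P p (i # J) \<longleftrightarrow> code_at P p [i] \<and> code_at P (Suc p) J"
  using code_at_append[of P p "[i]" J] by simp

lemma code_at_single: "code_at P p [i] \<Longrightarrow> p < length P \<and> P ! p = i"
  by (auto simp: code_at_def nth_append)

definition runs :: "nat \<Rightarrow> program \<Rightarrow> nat \<Rightarrow> config \<Rightarrow> nat \<Rightarrow> config \<Rightarrow> bool" where
  "runs w P b s k s' \<longleftrightarrow> (step w P ^^ k) s = s' \<and>
     (\<forall>j<k. step_addresses P ((step w P ^^ j) s) \<subseteq> {..<b})"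

lemma runs_0: "runs w P b s 0 s"
  by (simp add: runs_def)

lemma runs_trans:
  assumes "runs w P b s k s'" "runs w P b s' l s''"
  shows "runs w P b s (k + l) s''"
  unfolding runs_def
proof (intro conjI allI impI)
  have shift: "(step w P ^^ (k + j)) s = (step w P ^^ j) s'" for j
    using assms(1) by (simp add: runs_def add.commute[of k] funpow_add)
  then show "(step w P ^^ (k + l)) s = s''" using assms(2) by (simp add: runs_def)
  fix j assume "j < k + l"
  then show "step_addresses P ((step w P ^^ j) s) \<subseteq> {..<b}"
    using assms shift[of "j - k"] by (cases "j < k") (auto simp: runs_def)
qed

lemma runs_instr:
  assumes "code_at P (pc s) [i]" "i \<noteq> Halt" "instr_addresses i s \<subseteq> {..<b}"
  shows "runs w P b s 1 (exec_instr w i s)"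
  using code_at_single[OF assms(1)] assms(2,3)
  by (simp add: runs_def step_def halted_def step_addresses_def)

section \<open>Simulation of array programs by machine programs\<close>

locale compiled = array_machine n K "2 ^ w" for n K w +
  fixes P :: program
  assumes memory: "K * n < 2 ^ w"
begin

definition represents :: "config \<Rightarrow> state \<Rightarrow> bool" where
  "represents s = (\<lambda>(v, a). (\<forall>x. reg s (2 * x) = v x) \<and> (\<forall>A<K. reg s (2 * A + 3) = A * n) \<and>
     (\<forall>A<K. \<forall>i<n. mem s (A * n + i) = a A i))"

lemma cell_bound:
  assumes "A < K" "i < n"
  shows "A * n + i < K * n"
proof -
  have "A * n + i < Suc A * n" using assms(2) by simp
  also have "\<dots> \<le> K * n" using assms(1) by (intro mult_le_mono1) simp
  finally show ?thesis .
qed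

text \<open>Uniqueness of quotient and remainder modulo \<open>n\<close>. This makes the blocks of
  different arrays disjoint, so a \<open>Put\<close> leaves all other cells alone.\<close>

lemma cell_inject:
  assumes "i < n" "j < n"
  shows "A * n + i = B * n + j \<longleftrightarrow> A = B \<and> i = j"
proof
  assume eq: "A * n + i = B * n + j"
  have "(A * n + i) div n = A" "(B * n + j) div n = B" using assms by simp_all
  then have "A = B" using eq by simp
  then show "A = B \<and> i = j" using eq by simp
qed simp

lemma comp_basic_correct:
  assumes "basic_safe b q" "represents s q" "code_at P (pc s) (comp_basic b)"
  shows "\<exists>k s'. k \<le> 2 \<and> runs w P (K * n) s k s' \<and> represents s' (basic_exec b q) \<and>
    pc s' = pc s + length (comp_basic b)"
proof -
  obtain v a where q: "q = (v, a)" by force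
  \<comment> \<open>Parity separates the variables from the scratch register and from the base
    registers.\<close>
  have odd: "2 * x \<noteq> Suc 0" "2 * x \<noteq> Suc (Suc (Suc (2 * A)))"
    "Suc (Suc (Suc (2 * A))) \<noteq> 2 * x" "2 * x \<noteq> 2 * A + 3" "2 * A + 3 \<noteq> 2 * x" for x A :: nat
    by presburger+
  show ?thesis
  proof (cases b)
    case (Get x A y)
    have b: "A < K" "v y < n" using assms(1) by (auto simp: Get q)
    let ?s = "exec_instr w (Alu Add 1 (2 * A + 3) (2 * y)) s"
    have "A * n + v y < 2 ^ w" using cell_bound[OF b] memory by linarith
    then have adr: "reg ?s 1 = A * n + v y"
      using assms(2) b by (simp add: represents_def q)
    have 1: "runs w P (K * n) s 1 ?s"
      using assms(3) by (intro runs_instr) (auto simp: Get code_at_Cons[of _ _ _ "[_]"])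
    have 2: "runs w P (K * n) ?s 1 (exec_instr w (Load (2 * x) 1) ?s)"
      using assms(3) cell_bound[OF b] adr
      by (intro runs_instr) (auto simp: Get code_at_Cons[of _ _ _ "[_]"])
    have "represents (exec_instr w (Load (2 * x) 1) ?s) (basic_exec b q)"
      using assms(2) b adr by (auto simp: represents_def q Get odd)
    then show ?thesis
      using runs_trans[OF 1 2, unfolded one_add_one]
      by (intro exI[of _ 2] exI[of _ "exec_instr w (Load (2 * x) 1) ?s"]) (simp add: Get)
  next
    case (Put A y x)
    have b: "A < K" "v y < n" using assms(1) by (auto simp: Put q)
    let ?s = "exec_instr w (Alu Add 1 (2 * A + 3) (2 * y)) s"
    have "A * n + v y < 2 ^ w" using cell_bound[OF b] memory by linarith
    then have adr: "reg ?s 1 = A * n + v y"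
      using assms(2) b by (simp add: represents_def q)
    have 1: "runs w P (K * n) s 1 ?s"
      using assms(3) by (intro runs_instr) (auto simp: Put code_at_Cons[of _ _ _ "[_]"])
    have 2: "runs w P (K * n) ?s 1 (exec_instr w (Store 1 (2 * x)) ?s)"
      using assms(3) cell_bound[OF b] adr
      by (intro runs_instr) (auto simp: Put code_at_Cons[of _ _ _ "[_]"])
    have "represents (exec_instr w (Store 1 (2 * x)) ?s) (basic_exec b q)"
      using assms(2) b adr by (auto simp: represents_def q Put odd cell_inject)
    then show ?thesis
      using runs_trans[OF 1 2, unfolded one_add_one]
      by (intro exI[of _ 2] exI[of _ "exec_instr w (Store 1 (2 * x)) ?s"]) (simp add: Put)
  next
    case (Assign x k)
    have "runs w P (K * n) s 1 (exec_instr w (Const (2 * x) k) s)"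
      using Assign assms(3) by (intro runs_instr) auto
    moreover have "represents (exec_instr w (Const (2 * x) k) s) (basic_exec b q)"
      using Assign assms(1,2) odd by (auto simp: q represents_def)
    ultimately show ?thesis
      using Assign by (intro exI[of _ 1] exI) auto
  next
    case (Copy x y)
    have "runs w P (K * n) s 1 (exec_instr w (Move (2 * x) (2 * y)) s)"
      using Copy assms(3) by (intro runs_instr) auto
    moreover have "represents (exec_instr w (Move (2 * x) (2 * y)) s) (basic_exec b q)"
      using Copy assms(1,2) odd by (auto simp: q represents_def)
    ultimately show ?thesis
      using Copy by (intro exI[of _ 1] exI) auto
  next
    case (Plus x y z)
    have "runs w P (K * n) s 1 (exec_instr w (Alu Add (2 * x) (2 * y) (2 * z)) s)"
      using Plus assms(3) by (intro runs_instr) auto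
    moreover have "represents (exec_instr w (Alu Add (2 * x) (2 * y) (2 * z)) s) (basic_exec b q)"
      using Plus assms(1,2) odd by (auto simp: q represents_def)
    ultimately show ?thesis
      using Plus by (intro exI[of _ 1] exI) auto
  next
    case (Minus x y z)
    \<comment> \<open>\<open>Sub\<close> adds the complement \<open>2 ^ w - v z\<close>; the safety
      condition ensures that reduction modulo \<open>2 ^ w\<close> removes exactly the one surplus
      \<open>2 ^ w\<close>.\<close>
    then have "v y + (2 ^ w - v z) = (v y - v z) + 2 ^ w" "v y - v z < 2 ^ w"
      using assms(1) by (auto simp: q)
    then have sub: "(v y + (2 ^ w - v z)) mod 2 ^ w = v y - v z" by simp
    have "runs w P (K * n) s 1 (exec_instr w (Alu Sub (2 * x) (2 * y) (2 * z)) s)"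
      using Minus assms(3) by (intro runs_instr) auto
    moreover have "represents (exec_instr w (Alu Sub (2 * x) (2 * y) (2 * z)) s) (basic_exec b q)"
      using Minus sub assms(1,2) odd by (auto simp: q represents_def)
    ultimately show ?thesis
      using Minus by (intro exI[of _ 1] exI) auto
  qed
qed

lemma represents_pc [simp]: "represents (s\<lparr>pc := p\<rparr>) q = represents s q"
  by (simp add: represents_def)

lemma comp_cond_correct:
  assumes "represents s q" "code_at P (pc s) [comp_cond e l]"
  shows "runs w P b s 1 (s\<lparr>pc := if holds e q then l else pc s + 1\<rparr>)"
proof -
  have "exec_instr w (comp_cond e l) s = s\<lparr>pc := if holds e q then l else pc s + 1\<rparr>"
    using assms(1) by (cases e; cases q) (simp_all add: represents_def)
  moreover have "runs w P b s 1 (exec_instr w (comp_cond e l) s)"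
    using assms(2) by (intro runs_instr) (cases e; simp)+
  ultimately show ?thesis by simp
qed

lemma runs_jump: "code_at P (pc s) [Jump l] \<Longrightarrow> runs w P b s 1 (s\<lparr>pc := l\<rparr>)"
  using runs_instr[of P s "Jump l"] by simp

text \<open>Since \<open>runs\<close> also confines the addresses to \<open>{..<K * n}\<close>, one
  induction over the derivation transfers result, time and space. After an iteration, control is
  back at the start of the loop, so the hypothesis for the remaining iterations applies to the same
  code.\<close>

theorem comp_correct:
  assumes "big c q t q'" "represents s q" "code_at P (pc s) (comp (pc s) c)"
  shows "\<exists>k s'. k \<le> t \<and> runs w P (K * n) s k s' \<and> represents s' q' \<and> pc s' = pc s + len c"
  using assms
proof (induction c q t q' arbitrary: s rule: big.induct)
  case (Skip q)
  then show ?case using runs_0 by force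
next
  case (Basic b q)
  then show ?case using comp_basic_correct by simp
next
  case (Seq c q t q' d u q'')
  have code: "code_at P (pc s) (comp (pc s) c)" "code_at P (pc s + len c) (comp (pc s + len c) d)"
    using Seq.prems by (simp_all add: code_at_append)
  obtain k s' where 1: "k \<le> t" "runs w P (K * n) s k s'" "represents s' q'" "pc s' = pc s + len c"
    using Seq.IH(1)[OF Seq.prems(1) code(1)] by blast
  obtain l s'' where 2: "l \<le> u" "runs w P (K * n) s' l s''" "represents s'' q''"
    "pc s'' = pc s' + len d"
    using Seq.IH(2)[OF 1(3)] code(2) 1(4) by auto
  show ?case
    using 1 2 runs_trans[OF 1(2) 2(2)] by (intro exI[of _ "k + l"] exI[of _ s'']) simp
next
  case (IfTrue e q c t q' d)
  let ?p = "pc s + len d + 2"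
  have code: "code_at P (pc s) [comp_cond e ?p]" "code_at P ?p (comp ?p c)"
    using IfTrue.prems(2)
    by (simp_all add: code_at_append code_at_Cons[of _ _ _ "_ @ _"]
      code_at_Cons[of _ _ "Jump _" "comp _ _"])
  have 1: "runs w P (K * n) s 1 (s\<lparr>pc := ?p\<rparr>)"
    using comp_cond_correct[OF IfTrue.prems(1) code(1)] IfTrue.hyps(1) by simp
  obtain k s' where 2: "k \<le> t" "runs w P (K * n) (s\<lparr>pc := ?p\<rparr>) k s'" "represents s' q'"
    "pc s' = ?p + len c"
    using IfTrue.IH[of "s\<lparr>pc := ?p\<rparr>"] IfTrue.prems(1) code(2) by auto
  show ?case
    using 2 runs_trans[OF 1 2(2)] by (intro exI[of _ "1 + k"] exI[of _ s']) simp
next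
  case (IfFalse e q d t q' c)
  let ?p = "pc s + 1"
  have code: "code_at P (pc s) [comp_cond e (pc s + len d + 2)]" "code_at P ?p (comp ?p d)"
      "code_at P (?p + len d) [Jump (pc s + len d + 2 + len c)]"
    using IfFalse.prems(2)
    by (simp_all add: code_at_append code_at_Cons[of _ _ _ "_ @ _"]
      code_at_Cons[of _ _ "Jump _" "comp _ _"])
  have 1: "runs w P (K * n) s 1 (s\<lparr>pc := ?p\<rparr>)"
    using comp_cond_correct[OF IfFalse.prems(1) code(1)] IfFalse.hyps(1) by simp
  obtain k s' where 2: "k \<le> t" "runs w P (K * n) (s\<lparr>pc := ?p\<rparr>) k s'" "represents s' q'"
    "pc s' = ?p + len d"
    using IfFalse.IH[of "s\<lparr>pc := ?p\<rparr>"] IfFalse.prems(1) code(2) by auto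
  let ?s = "s'\<lparr>pc := pc s + len d + 2 + len c\<rparr>"
  have 3: "runs w P (K * n) s' 1 ?s"
    using runs_jump[of s'] 2(4) code(3) by simp
  show ?case
    using 2 runs_trans[OF 1 runs_trans[OF 2(2) 3]]
    by (intro exI[of _ "1 + (k + 1)"] exI[of _ ?s]) simp
next
  case (WhileFalse e q c)
  let ?p = "pc s + len c + 3"
  have code: "code_at P (pc s) [comp_cond e (pc s + 2)]" "code_at P (pc s + 1) [Jump ?p]"
    using WhileFalse.prems(2)
    by (simp_all add: code_at_append code_at_Cons[of _ _ _ "_ @ _"] code_at_Cons[of _ _ _ "_ # _"])
  have 1: "runs w P (K * n) s 1 (s\<lparr>pc := pc s + 1\<rparr>)"
    using comp_cond_correct[OF WhileFalse.prems(1) code(1)] WhileFalse.hyps by simp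
  have 2: "runs w P (K * n) (s\<lparr>pc := pc s + 1\<rparr>) 1 (s\<lparr>pc := ?p\<rparr>)"
    using runs_jump[of "s\<lparr>pc := pc s + 1\<rparr>"] code(2) by simp
  show ?case
    using runs_trans[OF 1 2] WhileFalse.prems
    by (intro exI[of _ "1 + 1"] exI[of _ "s\<lparr>pc := ?p\<rparr>"]) simp
next
  case (WhileTrue e q c t q' u q'')
  let ?p = "pc s + 2"
  have code: "code_at P (pc s) [comp_cond e ?p]" "code_at P ?p (comp ?p c)"
      "code_at P (?p + len c) [Jump (pc s)]"
    using WhileTrue.prems(2)
    by (simp_all add: code_at_append code_at_Cons[of _ _ _ "_ @ _"] code_at_Cons[of _ _ _ "_ # _"])
  have 1: "runs w P (K * n) s 1 (s\<lparr>pc := ?p\<rparr>)"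
    using comp_cond_correct[OF WhileTrue.prems(1) code(1)] WhileTrue.hyps(1) by simp
  obtain k s' where 2: "k \<le> t" "runs w P (K * n) (s\<lparr>pc := ?p\<rparr>) k s'" "represents s' q'"
    "pc s' = ?p + len c"
    using WhileTrue.IH(1)[of "s\<lparr>pc := ?p\<rparr>"] WhileTrue.prems(1) code(2) by auto
  let ?s = "s'\<lparr>pc := pc s\<rparr>"
  have 3: "runs w P (K * n) s' 1 ?s"
    using runs_jump[of s'] 2(4) code(3) by simp
  obtain l s'' where 4: "l \<le> u" "runs w P (K * n) ?s l s''" "represents s'' q''"
    "pc s'' = pc s + len (While e c)"
    using WhileTrue.IH(2)[of ?s] 2(3) WhileTrue.prems(2) by auto
  show ?case
    using 2 4 runs_trans[OF 1 runs_trans[OF 2(2) runs_trans[OF 3 4(2)]]]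
    by (intro exI[of _ "1 + (k + (1 + l))"] exI[of _ s'']) simp
qed

end

section \<open>Hoare logic with running times\<close>

fun basic_var :: "basic \<Rightarrow> nat set" where
  "basic_var (Assign x k) = {x}"
| "basic_var (Copy x y) = {x}"
| "basic_var (Plus x y z) = {x}"
| "basic_var (Minus x y z) = {x}"
| "basic_var (Get x A y) = {x}"
| "basic_var (Put A y x) = {}"

fun basic_arr :: "basic \<Rightarrow> nat set" where
  "basic_arr (Put A y x) = {A}"
| "basic_arr _ = {}"

fun vars :: "com \<Rightarrow> nat set" where
  "vars Skip = {}"
| "vars (Basic b) = basic_var b"
| "vars (c \<Zsemi> d) = vars c \<union> vars d"
| "vars (If e c d) = vars c \<union> vars d"
| "vars (While e c) = vars c"

fun arrs :: "com \<Rightarrow> nat set" where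
  "arrs Skip = {}"
| "arrs (Basic b) = basic_arr b"
| "arrs (c \<Zsemi> d) = arrs c \<union> arrs d"
| "arrs (If e c d) = arrs c \<union> arrs d"
| "arrs (While e c) = arrs c"

text \<open>A time bound for loop-free code. Adding up both branches instead of taking the maximum
  only affects constants. The value at \<open>While\<close> is a dummy: \<open>wp\<close> is
  \<open>False\<close> there, and loops are bounded by \<open>triple_While\<close>.\<close>

fun cost :: "com \<Rightarrow> nat" where
  "cost Skip = 0"
| "cost (Basic b) = 2"
| "cost (c \<Zsemi> d) = cost c + cost d"
| "cost (If e c d) = cost c + cost d + 2"
| "cost (While e c) = 0"

definition same_outside :: "com \<Rightarrow> state \<Rightarrow> state \<Rightarrow> bool" where
  "same_outside c = (\<lambda>(v, a) (v', a'). (\<forall>x. x \<notin> vars c \<longrightarrow> v' x = v x) \<and> (\<forall>A. A \<notin> arrs c \<longrightarrow> a' A = a A))"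

lemma same_outside_refl [simp]: "same_outside c s s"
  by (auto simp: same_outside_def)

lemma same_outside_trans:
  "same_outside c s s' \<Longrightarrow> same_outside d s' s'' \<Longrightarrow>
    vars c \<union> vars d \<subseteq> vars e \<Longrightarrow> arrs c \<union> arrs d \<subseteq> arrs e \<Longrightarrow> same_outside e s s''"
  by (cases s; cases s'; cases s'') (simp add: same_outside_def subset_iff, metis)

lemma same_outside_mono:
  "same_outside c s s' \<Longrightarrow> vars c \<subseteq> vars e \<Longrightarrow> arrs c \<subseteq> arrs e \<Longrightarrow> same_outside e s s'"
  by (cases s; cases s') (simp add: same_outside_def subset_iff, metis)

context array_machine
begin

lemma big_same_outside: "big c s t s' \<Longrightarrow> same_outside c s s'"
proof (induction rule: big.induct)
  case (Basic b s)
  then show ?case by (cases b; cases s) (auto simp: same_outside_def)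
next
  case (Seq c s t s' d u s'')
  then show ?case by (auto intro: same_outside_trans)
next
  case (WhileTrue e s c t s' u s'')
  then show ?case by (auto intro: same_outside_trans)
qed (auto intro: same_outside_mono)

text \<open>The start state is given explicitly instead of by a precondition, so that postconditions
  can mention its contents. The rules below add the frame facts of \<open>big_same_outside\<close>
  automatically.\<close>

definition triple :: "com \<Rightarrow> nat \<Rightarrow> state \<Rightarrow> (state \<Rightarrow> bool) \<Rightarrow> bool" where
  "triple c T s Q \<longleftrightarrow> (\<exists>t\<le>T. \<exists>s'. big c s t s' \<and> Q s')"

lemma triple_weaken:
  assumes "triple c T s Q" "T \<le> U"
    and "\<And>v a. same_outside c s (v, a) \<Longrightarrow> Q (v, a) \<Longrightarrow> R (v, a)"
  shows "triple c U s R"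
proof -
  obtain t v a where 1: "t \<le> T" "big c s t (v, a)" "Q (v, a)"
    using assms(1) unfolding triple_def by force
  have "R (v, a)" using assms(3)[OF big_same_outside[OF 1(2)] 1(3)] .
  then show ?thesis using 1 assms(2) unfolding triple_def by (meson le_trans)
qed

lemma triple_Seq:
  assumes "triple c T s Q"
    and "\<And>v a. same_outside c s (v, a) \<Longrightarrow> Q (v, a) \<Longrightarrow> triple d U (v, a) R"
  shows "triple (c \<Zsemi> d) (T + U) s R"
proof -
  obtain t v a where 1: "t \<le> T" "big c s t (v, a)" "Q (v, a)"
    using assms(1) unfolding triple_def by force
  have "triple d U (v, a) R" using assms(2)[OF big_same_outside[OF 1(2)] 1(3)] .
  then obtain u s'' where 2: "u \<le> U" "big d (v, a) u s''" "R s''"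
    unfolding triple_def by blast
  show ?thesis
    unfolding triple_def
    using 1 2 big.Seq[OF 1(2) 2(2)] by (intro exI[of _ "t + u"] conjI exI[of _ s'']) auto
qed

lemma triple_Seq_eq:
  "triple c T s (\<lambda>s'. s' = s\<^sub>1) \<Longrightarrow> triple d U s\<^sub>1 R \<Longrightarrow> triple (c \<Zsemi> d) (T + U) s R"
  by (rule triple_Seq[where Q = "\<lambda>s'. s' = s\<^sub>1"]) auto

text \<open>The measure decreases in every iteration and so bounds their number; each costs at most
  \<open>T\<close> and two jumps, and the failing test at the end costs 2.\<close>

lemma triple_While:
  assumes "I s"
    and step: "\<And>v a. same_outside c s (v, a) \<Longrightarrow> I (v, a) \<Longrightarrow> holds e (v, a) \<Longrightarrow>
      triple c T (v, a) (\<lambda>s'. I s' \<and> f s' < f (v, a))"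
    and "f s \<le> B" "\<And>v a. same_outside c s (v, a) \<Longrightarrow> I (v, a) \<Longrightarrow> \<not> holds e (v, a) \<Longrightarrow> Q (v, a)"
  shows "triple (While e c) (B * (T + 2) + 2) s Q"
proof -
  \<comment> \<open>The frame is taken relative to the start \<open>s\<close> of the whole loop, so
    that it survives any number of iterations.\<close>
  have "I q \<Longrightarrow> same_outside c s q \<Longrightarrow>
    \<exists>t\<le>f q * (T + 2) + 2. \<exists>s'. big (While e c) q t s' \<and> I s' \<and> \<not> holds e s' \<and> same_outside c s s'" for q
  proof (induction "f q" arbitrary: q rule: less_induct)
    case less
    obtain v a where q: "q = (v, a)" by force
    show ?case
    proof (cases "holds e q")
      case False
      then show ?thesis using less.prems
        by (intro exI[of _ 2] conjI exI[of _ q]) (auto intro: big.intros)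
    next
      case True
      then obtain t s' where 1: "t \<le> T" "big c q t s'" "I s'" "f s' < f q"
        using step[of v a] less.prems by (auto simp: q triple_def)
      have 2: "same_outside c s s'"
        using less.prems(2) big_same_outside[OF 1(2)] by (auto intro: same_outside_trans)
      obtain u s'' where 3: "u \<le> f s' * (T + 2) + 2" "big (While e c) s' u s''"
        "I s''" "\<not> holds e s''" "same_outside c s s''"
        using less.hyps[OF 1(4,3) 2] by blast
      have "big (While e c) q (t + 2 + u) s''" by (rule big.WhileTrue[OF True 1(2) 3(2)])
      moreover have "t + 2 + u \<le> f q * (T + 2) + 2"
      proof -
        have "t + 2 + u \<le> Suc (f s') * (T + 2) + 2" using 1(1) 3(1) by simp
        also have "\<dots> \<le> f q * (T + 2) + 2" using 1(4) by (intro add_right_mono mult_le_mono1) simp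
        finally show ?thesis .
      qed
      ultimately show ?thesis using 3 by blast
    qed
  qed
  from this[OF assms(1)] obtain t v a where 1: "t \<le> f s * (T + 2) + 2"
    "big (While e c) s t (v, a)" "I (v, a)" "\<not> holds e (v, a)" "same_outside c s (v, a)"
    by force
  have "f s * (T + 2) \<le> B * (T + 2)" using assms(3) by (rule mult_le_mono1)
  with 1(1) have "t \<le> B * (T + 2) + 2" by linarith
  then show ?thesis
    unfolding triple_def using 1(2) assms(4)[OF 1(5,3,4)] by blast
qed

text \<open>Rewriting with these equations executes a loop body symbolically and leaves the safety
  conditions as side goals.\<close>

fun wp :: "com \<Rightarrow> (state \<Rightarrow> bool) \<Rightarrow> state \<Rightarrow> bool" where
  "wp Skip Q s \<longleftrightarrow> Q s"
| "wp (Basic b) Q s \<longleftrightarrow> basic_safe b s \<and> Q (basic_exec b s)"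
| "wp (c \<Zsemi> d) Q s \<longleftrightarrow> wp c (wp d Q) s"
| "wp (If e c d) Q s \<longleftrightarrow> (if holds e s then wp c Q s else wp d Q s)"
| "wp (While e c) Q s \<longleftrightarrow> False"

lemma wp_mono: "wp c Q s \<Longrightarrow> (\<And>s. Q s \<Longrightarrow> R s) \<Longrightarrow> wp c R s"
  by (induction c arbitrary: Q R s) (auto split: if_splits)

lemma triple_wp: "wp c Q s \<Longrightarrow> triple c (cost c) s Q"
proof (induction c arbitrary: Q s)
  case (Seq c d)
  then have "triple c (cost c) s (wp d Q)" by simp
  then show ?case using Seq.IH(2) by (auto intro: triple_Seq)
next
  case (If e c d)
  show ?case
  proof (cases "holds e s")
    case True
    then obtain t s' where 1: "t \<le> cost c" "big c s t s'" "Q s'"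
      using If.IH(1)[of Q s] If.prems True unfolding triple_def by auto
    have "big (com.If e c d) s (t + 2) s'" by (rule big.IfTrue[OF True 1(2)])
    then show ?thesis unfolding triple_def using 1 by (intro exI[of _ "t + 2"] conjI exI[of _ s']) auto
  next
    case False
    then obtain t s' where 1: "t \<le> cost d" "big d s t s'" "Q s'"
      using If.IH(2)[of Q s] If.prems False unfolding triple_def by auto
    have "big (com.If e c d) s (t + 2) s'" by (rule big.IfFalse[OF False 1(2)])
    then show ?thesis unfolding triple_def using 1 by (intro exI[of _ "t + 2"] conjI exI[of _ s']) auto
  qed
next
  case (Basic b)
  then show ?case unfolding triple_def
    by (intro exI[of _ 2] conjI exI[of _ "basic_exec b s"]) (auto intro: big.Basic)
next
  case Skip
  then show ?case unfolding triple_def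
    by (intro exI[of _ 0] conjI exI[of _ s]) (auto intro: big.Skip)
qed simp

end

section \<open>Refining a partition by a second key\<close>

text \<open>A partition of the positions is represented by the function \<open>f\<close> that maps each position
  to the least position of its class.\<close>

definition canonical :: "(nat \<Rightarrow> nat) \<Rightarrow> bool" where
  "canonical f \<longleftrightarrow> (\<forall>i. f i \<le> i \<and> f (f i) = f i)"

text \<open>The minimum is over all naturals. It is at most \<open>i\<close>, so for
  \<open>i < N\<close> it agrees with the minimum over the positions below \<open>N\<close>.\<close>

definition meet :: "(nat \<Rightarrow> nat) \<Rightarrow> (nat \<Rightarrow> nat) \<Rightarrow> nat \<Rightarrow> nat" where
  "meet f g i = (LEAST j. f j = f i \<and> g j = g i)"

lemma meet_le: "f j = f i \<Longrightarrow> g j = g i \<Longrightarrow> meet f g i \<le> j"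
  unfolding meet_def by (rule Least_le) simp

lemma meet_same: "f (meet f g i) = f i \<and> g (meet f g i) = g i"
  unfolding meet_def by (rule LeastI[where k = i]) simp

lemma meet_cong: "f j = f i \<Longrightarrow> g j = g i \<Longrightarrow> meet f g j = meet f g i"
  unfolding meet_def by simp

lemma meet_idem: "meet f g (meet f g i) = meet f g i"
  using meet_same[of f g i] by (intro meet_cong) auto

section \<open>Traversal of the classes by increasing representative\<close>

definition next_in_class :: "nat \<Rightarrow> (nat \<Rightarrow> nat) \<Rightarrow> nat \<Rightarrow> nat \<Rightarrow> bool" where
  "next_in_class N f p q \<longleftrightarrow> p < q \<and> (q < N \<and> f q = f p \<or> q = N) \<and>
     (\<forall>j. p < j \<and> j < q \<longrightarrow> f j \<noteq> f p)"

text \<open>The classes of \<open>f\<close> are traversed one after the other, each in increasing order; \<open>b\<close> is the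
  current class and \<open>p\<close> the next position in it (\<open>N\<close> if there is none).\<close>

definition visited :: "(nat \<Rightarrow> nat) \<Rightarrow> nat \<Rightarrow> nat \<Rightarrow> nat \<Rightarrow> bool" where
  "visited f b p i \<longleftrightarrow> f i < b \<or> f i = b \<and> i < p"

text \<open>Invariant of the traversal: \<open>h\<close> is the refinement, \<open>ct\<close>
  counts, at representatives only, the members visited so far, and \<open>idx\<close> sends a second
  key to the representative filed under it. The last is claimed only for keys already met in the
  current class of \<open>f\<close>.\<close>

definition grouping :: "nat \<Rightarrow> (nat \<Rightarrow> nat) \<Rightarrow> (nat \<Rightarrow> nat) \<Rightarrow> nat \<Rightarrow> nat \<Rightarrow>
    (nat \<Rightarrow> nat) \<Rightarrow> (nat \<Rightarrow> nat) \<Rightarrow> (nat \<Rightarrow> nat) \<Rightarrow> bool" where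
  "grouping N f g b p h ct idx \<longleftrightarrow> b \<le> N \<and> p \<le> N \<and> (p < N \<longrightarrow> f p = b) \<and>
     (\<forall>i<N. visited f b p i \<longrightarrow> h i = meet f g i \<and>
        (meet f g i = i \<longrightarrow> ct i = card {j. j < N \<and> visited f b p j \<and> f j = f i \<and> g j = g i})) \<and>
     (\<forall>i<N. f i = b \<and> i < p \<longrightarrow> idx (g i) = meet f g i)"

text \<open>A measure for a nested traversal that is written as a single loop: a visit lowers the
  first summand, and moving on to the next class keeps it and lowers the second. Its bound
  \<open>2 * N\<close> makes the whole traversal linear, however the classes are
  distributed.\<close>

definition unvisited :: "nat \<Rightarrow> (nat \<Rightarrow> nat) \<Rightarrow> nat \<Rightarrow> nat \<Rightarrow> nat" where
  "unvisited N f b p = card {i. i < N \<and> \<not> visited f b p i} + (N - b)"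

text \<open>Entries of \<open>idx\<close> that are left over from earlier classes or earlier calls are harmless:
  an entry is trusted only if it points to an earlier position with the same two keys.\<close>

lemma candidate_eq_meet:
  assumes "grouping N f g b p h ct idx" "p < N"
  shows "(if idx (g p) < p \<and> f (idx (g p)) = b \<and> g (idx (g p)) = g p then idx (g p) else p) =
    meet f g p"
proof (cases "meet f g p < p")
  case True
  define r where "r = meet f g p"
  have r: "r < p" "f r = f p" "g r = g p" "meet f g r = r"
    using True meet_same[of f g p] meet_idem[of f g p] by (simp_all add: r_def)
  have b: "f p = b" "\<And>i. i < N \<Longrightarrow> f i = b \<Longrightarrow> i < p \<Longrightarrow> idx (g i) = meet f g i"
    using assms by (auto simp: grouping_def)
  \<comment> \<open>The bucket invariant is applied at \<open>r\<close> instead of \<open>p\<close>: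
    \<open>r\<close> belongs to the current class, precedes \<open>p\<close>, and has the same
    second key.\<close>
  have "idx (g r) = meet f g r" using r b(1) assms(2) by (intro b(2)) linarith+
  then have "idx (g p) = r" using r(3,4) by simp
  then show ?thesis using r b(1) unfolding r_def[symmetric] by simp
next
  case False
  then have "meet f g p = p" using meet_le[of f p p g] by simp
  moreover have "f p = b" using assms by (simp add: grouping_def)
  \<comment> \<open>An entry that passes the test would be a member of the class of \<open>p\<close>
    before \<open>p\<close>.\<close>
  moreover have "\<not> (idx (g p) < p \<and> f (idx (g p)) = f p \<and> g (idx (g p)) = g p)"
    using meet_le[of f "idx (g p)" p g] \<open>meet f g p = p\<close> by linarith
  ultimately show ?thesis by argo
qed

lemma visited_step:
  assumes "f p = b" "next_in_class N f p q" "i < N"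
  shows "visited f b q i \<longleftrightarrow> visited f b p i \<or> i = p"
  using assms by (auto simp: visited_def next_in_class_def) (metis linorder_neqE_nat)+

text \<open>A position that opens a new class takes over its bucket and resets its counter just
  before the common increment. Leftovers are thus overwritten exactly when they would begin to
  matter.\<close>

lemma grouping_visit:
  assumes inv: "grouping N f g b p h ct idx" and "p < N" and nx: "next_in_class N f p q"
    and idx': "idx' = (if meet f g p = p then idx(g p := p) else idx)"
    and ct': "ct' = (if meet f g p = p then ct(p := 0) else ct)"
  shows "grouping N f g b q (h(p := meet f g p)) (ct'(meet f g p := Suc (ct' (meet f g p)))) idx'"
    (is "grouping N f g b q ?h ?ct idx'")
proof -
  have fp: "f p = b" using inv \<open>p < N\<close> by (simp add: grouping_def)
  note vis = visited_step[OF fp nx]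
  have not_vis: "\<not> visited f b p p" using fp by (simp add: visited_def)
  have vis_earlier: "j < p" if "visited f b p j" "f j = f p" for j
    using that fp by (auto simp: visited_def)
  have "?h i = meet f g i" if "i < N" "visited f b q i" for i
    using that vis inv by (auto simp: grouping_def)
  moreover have "?ct i = card {j. j < N \<and> visited f b q j \<and> f j = f i \<and> g j = g i}"
    if i: "i < N" "visited f b q i" "meet f g i = i" for i
  proof (cases "i = p")
    case True
    \<comment> \<open>Visits within a class of \<open>f\<close> are in increasing order, so when the
      least member \<open>p\<close> is visited no other member has been.\<close>
    have "{j. j < N \<and> visited f b q j \<and> f j = f i \<and> g j = g i} = {p}"
      using True vis vis_earlier meet_le[of f _ p g] i \<open>p < N\<close> by fastforce
    then show ?thesis using True i ct' by simp
  next
    case False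
    then have vi: "visited f b p i" using i vis by simp
    then have ct: "ct i = card {j. j < N \<and> visited f b p j \<and> f j = f i \<and> g j = g i}"
      using inv i by (simp add: grouping_def)
    show ?thesis
    proof (cases "f p = f i \<and> g p = g i")
      case True
      then have r: "meet f g p = i" using meet_cong[of f p i g] i by simp
      have "{j. j < N \<and> visited f b q j \<and> f j = f i \<and> g j = g i} =
          insert p {j. j < N \<and> visited f b p j \<and> f j = f i \<and> g j = g i}"
        using vis True \<open>p < N\<close> by auto
      then show ?thesis using r ct ct' False not_vis by simp
    next
      case diff: False
      then have "meet f g p \<noteq> i" using meet_same[of f g p] by auto
      moreover have "{j. j < N \<and> visited f b q j \<and> f j = f i \<and> g j = g i} =
          {j. j < N \<and> visited f b p j \<and> f j = f i \<and> g j = g i}"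
        using vis diff by auto
      ultimately show ?thesis using ct ct' False by simp
    qed
  qed
  moreover have "idx' (g i) = meet f g i" if i: "i < N" "f i = b" "i < q" for i
  proof -
    have "visited f b q i" using i by (simp add: visited_def)
    then consider "i = p" | "i < p" using vis vis_earlier i fp by auto
    then show ?thesis
    proof cases
      case 1
      have "idx (g p) = meet f g p" if "meet f g p \<noteq> p"
        using candidate_eq_meet[OF inv \<open>p < N\<close>] that by (auto split: if_splits)
      then show ?thesis using 1 idx' by auto
    next
      case 2
      then have "idx (g i) = meet f g i" using inv i by (simp add: grouping_def)
      \<comment> \<open>Overwriting the bucket of \<open>g p\<close> destroys no trusted entry: an
        earlier member of the current class with the same second key would contradict
        \<open>meet f g p = p\<close>.\<close>
      moreover have "g i \<noteq> g p" if "meet f g p = p"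
        using that meet_le[of f i p g] 2 fp i by auto
      ultimately show ?thesis using idx' by auto
    qed
  qed
  moreover have "q \<le> N" "q < N \<longrightarrow> f q = b" "b \<le> N"
    using nx fp inv by (auto simp: next_in_class_def grouping_def)
  ultimately show ?thesis unfolding grouping_def by blast
qed

lemma unvisited_visit:
  assumes "f p = b" "p < N" "next_in_class N f p q"
  shows "unvisited N f b q < unvisited N f b p"
proof -
  have "{i. i < N \<and> \<not> visited f b q i} \<subset> {i. i < N \<and> \<not> visited f b p i}"
    using visited_step[OF assms(1,3)] assms(1,2) by (auto simp: visited_def)
  then show ?thesis unfolding unvisited_def by (simp add: psubset_card_mono)
qed

text \<open>If \<open>Suc b\<close> is a position representing itself, all members of its class are
  at least \<open>Suc b\<close>, where the traversal resumes. Otherwise canonicity leaves this class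
  without positions below \<open>N\<close>. In both cases no position changes its status.\<close>

lemma visited_advance:
  assumes "canonical f" "q = (if f (Suc b) = Suc b \<and> Suc b < N then Suc b else N)" "i < N"
  shows "visited f (Suc b) q i \<longleftrightarrow> visited f b N i"
proof -
  have "f i \<le> i" "f (f i) = f i" using assms(1) by (auto simp: canonical_def)
  then show ?thesis using assms(2,3) by (auto simp: visited_def less_Suc_eq split: if_splits)
qed

lemma grouping_advance:
  assumes "canonical f" "grouping N f g b N h ct idx" "b < N"
    "q = (if f (Suc b) = Suc b \<and> Suc b < N then Suc b else N)"
  shows "grouping N f g (Suc b) q h ct idx"
proof -
  note vis = visited_advance[OF assms(1,4)]
  have sets: "{j. j < N \<and> visited f (Suc b) q j \<and> f j = f i \<and> g j = g i} =
     {j. j < N \<and> visited f b N j \<and> f j = f i \<and> g j = g i}" for i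
    using vis by blast
  have none: "\<not> (f i = Suc b \<and> i < q)" if "i < N" for i
  proof
    assume "f i = Suc b \<and> i < q"
    moreover have "f i \<le> i" "f (f i) = f i" using assms(1) by (auto simp: canonical_def)
    ultimately have "f (Suc b) = Suc b" "Suc b \<le> i" "i < q" by metis+
    then show False using assms(4) that by (simp split: if_splits)
  qed
  have h: "\<forall>i<N. visited f b N i \<longrightarrow> h i = meet f g i \<and> (meet f g i = i \<longrightarrow>
      ct i = card {j. j < N \<and> visited f b N j \<and> f j = f i \<and> g j = g i})"
    using assms(2) unfolding grouping_def by (elim conjE) assumption
  show ?thesis
    unfolding grouping_def sets
  proof (intro conjI allI impI; (elim conjE)?)
    show "Suc b \<le> N" "q \<le> N" using assms(3,4) by simp_all
    show "f q = Suc b" if "q < N" using assms(4) that by (simp split: if_splits)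
    fix i assume i: "i < N"
    show "h i = meet f g i" if "visited f (Suc b) q i" using h[rule_format, OF i] vis[OF i] that by simp
    show "ct i = card {j. j < N \<and> visited f b N j \<and> f j = f i \<and> g j = g i}"
      if "visited f (Suc b) q i" "meet f g i = i"
      using h[rule_format, OF i] vis[OF i] that by simp
    show "idx (g i) = meet f g i" if "f i = Suc b" "i < q" using none i that by blast
  qed
qed

lemma unvisited_advance:
  assumes "canonical f" "b < N" "q = (if f (Suc b) = Suc b \<and> Suc b < N then Suc b else N)"
  shows "unvisited N f (Suc b) q < unvisited N f b N"
proof -
  have "{i. i < N \<and> \<not> visited f (Suc b) q i} = {i. i < N \<and> \<not> visited f b N i}"
    using visited_advance[OF assms(1,3)] by auto
  then show ?thesis using assms(2) by (simp add: unvisited_def)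
qed

lemma unvisited_le: "unvisited N f b p \<le> 2 * N"
proof -
  have "card {i. i < N \<and> \<not> visited f b p i} \<le> card {..<N}" by (rule card_mono) auto
  then show ?thesis by (simp add: unvisited_def)
qed

lemma grouping_start:
  assumes "canonical f"
  shows "grouping N f g 0 0 h ct idx"
proof -
  have "f 0 = 0" using assms by (metis canonical_def le_zero_eq)
  then show ?thesis by (auto simp: grouping_def visited_def)
qed

lemma grouping_end:
  assumes "canonical f" "grouping N f g N p h ct idx" "i < N"
  shows "h i = meet f g i \<and>
    (meet f g i = i \<longrightarrow> ct i = card {j. j < N \<and> f j = f i \<and> g j = g i})"
proof -
  have vis: "visited f N p j" if "j < N" for j
    using assms(1) that by (metis canonical_def le_less_trans visited_def)
  then have "{j. j < N \<and> visited f N p j \<and> f j = f i \<and> g j = g i} =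
      {j. j < N \<and> f j = f i \<and> g j = g i}" by auto
  then show ?thesis using assms(2,3) vis[OF assms(3)] by (simp add: grouping_def)
qed

text \<open>The classes are linked by a traversal from right to left, with \<open>first x\<close> the least position of class
  \<open>x\<close> seen so far.  Again, an old entry of \<open>first\<close> is recognised as such.\<close>

definition linking :: "nat \<Rightarrow> (nat \<Rightarrow> nat) \<Rightarrow> nat \<Rightarrow> (nat \<Rightarrow> nat) \<Rightarrow> (nat \<Rightarrow> nat) \<Rightarrow> bool" where
  "linking N f i first nx \<longleftrightarrow> i \<le> N \<and> (\<forall>p. i \<le> p \<and> p < N \<longrightarrow> next_in_class N f p (nx p) \<and>
     i \<le> first (f p) \<and> first (f p) \<le> p \<and> f (first (f p)) = f p)"

lemma linking_step:
  assumes "linking N f (Suc i) first nx"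
    and t: "t = (if i < first (f i) \<and> first (f i) < N \<and> f (first (f i)) = f i then first (f i) else N)"
  shows "linking N f i (first(f i := i)) (nx(i := t))"
proof -
  have i: "i < N" using assms(1) by (simp add: linking_def)
  have old: "next_in_class N f p (nx p) \<and> i < first (f p) \<and> first (f p) \<le> p \<and>
      f (first (f p)) = f p" if "i < p" "p < N" for p
    using assms(1) that unfolding linking_def Suc_le_eq by blast
  have "f j \<noteq> f i" if "i < j" "j < t" for j
  proof
    assume eq: "f j = f i"
    have "t \<le> N" using t by presburger
    \<comment> \<open>The invariant at the later class member \<open>j\<close> shows that
      \<open>first (f i)\<close> is genuine and at most \<open>j\<close>. The test then selects it,
      which gives \<open>t \<le> j\<close>.\<close>
    then have "i < first (f i)" "first (f i) \<le> j" "f (first (f i)) = f i" "j < N"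
      using old[of j] that unfolding eq by linarith+
    then show False using that t by presburger
  qed
  moreover have "i < t \<and> (t < N \<and> f t = f i \<or> t = N)" using t i by presburger
  ultimately have "next_in_class N f i t" by (simp add: next_in_class_def)
  then show ?thesis
    unfolding linking_def
  proof (intro conjI allI impI; (elim conjE)?)
    show "i \<le> N" using i by simp
    fix p assume p: "i \<le> p" "p < N"
    show "next_in_class N f p ((nx(i := t)) p)"
      using p old[of p] \<open>next_in_class N f i t\<close> by (cases "p = i") simp_all
    show "i \<le> (first(f i := i)) (f p)" using p old[of p] by (cases "p = i") simp_all
    show "(first(f i := i)) (f p) \<le> p" using p old[of p] by (cases "p = i") simp_all
    show "f ((first(f i := i)) (f p)) = f p" using p old[of p] by (cases "p = i") simp_all
  qed
qed

text \<open>The numbers of \<open>V_n\<close>, \<open>A_text\<close> and \<open>A_result\<close> are dictated by the input and output conventions.\<close>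

abbreviation (input) "V_n \<equiv> 0 :: nat"
abbreviation (input) "V_len \<equiv> 2 :: nat"
abbreviation (input) "V_one \<equiv> 3 :: nat"
abbreviation (input) "V_i \<equiv> 4 :: nat"
abbreviation (input) "V_k \<equiv> 5 :: nat"
abbreviation (input) "V_k' \<equiv> 6 :: nat"
abbreviation (input) "V_r \<equiv> 7 :: nat"
abbreviation (input) "V_t \<equiv> 8 :: nat"
abbreviation (input) "V_c \<equiv> 9 :: nat"
abbreviation (input) "V_p \<equiv> 10 :: nat"
abbreviation (input) "V_b \<equiv> 11 :: nat"
abbreviation (input) "V_x \<equiv> 12 :: nat"
abbreviation (input) "V_zero \<equiv> 13 :: nat"
abbreviation (input) "V_m \<equiv> 14 :: nat"

abbreviation (input) "A_text \<equiv> 0 :: nat"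
abbreviation (input) "A_result \<equiv> 1 :: nat"
abbreviation (input) "A_prefix \<equiv> 2 :: nat"
abbreviation (input) "A_key \<equiv> 3 :: nat"
abbreviation (input) "A_meet \<equiv> 4 :: nat"
abbreviation (input) "A_first \<equiv> 5 :: nat"
abbreviation (input) "A_next \<equiv> 6 :: nat"
abbreviation (input) "A_index \<equiv> 7 :: nat"
abbreviation (input) "A_count \<equiv> 8 :: nat"
abbreviation (input) "A_time \<equiv> 9 :: nat"
abbreviation (input) "A_parent \<equiv> 10 :: nat"
abbreviation (input) "A_suffix \<equiv> 11 :: nat"
abbreviation (input) "A_equal \<equiv> 12 :: nat"

section \<open>Programs for linking, grouping and refining\<close>

definition for_loop :: "com \<Rightarrow> com" where
  "for_loop c = Basic (Assign V_i 0) \<Zsemi>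
     While (Less V_i V_len) (c \<Zsemi> Basic (Plus V_i V_i V_one))"

text \<open>The order of the tests matters: a leftover in \<open>A_first\<close> need not be a valid
  index, so \<open>V_r\<close> is compared with \<open>V_len\<close> before \<open>F\<close> is read
  there.\<close>

definition link_step :: "nat \<Rightarrow> com" where
  "link_step F = Basic (Minus V_i V_i V_one) \<Zsemi> Basic (Get V_x F V_i) \<Zsemi>
     Basic (Get V_r A_first V_x) \<Zsemi> Basic (Put A_first V_x V_i) \<Zsemi> Basic (Copy V_t V_len) \<Zsemi>
     If (Less V_i V_r)
       (If (Less V_r V_len)
         (Basic (Get V_c F V_r) \<Zsemi> If (Equal V_c V_x) (Basic (Copy V_t V_r)) Skip) Skip) Skip \<Zsemi>
     Basic (Put A_next V_i V_t)"

definition link :: "nat \<Rightarrow> com" where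
  "link F = Basic (Copy V_i V_len) \<Zsemi> While (Less V_zero V_i) (link_step F)"

text \<open>As in \<open>link_step\<close>, comparing \<open>V_r\<close> with \<open>V_p\<close>
  first makes the later reads at \<open>V_r\<close> safe. Every failing test falls back to
  \<open>V_p\<close>, which then opens a new class.\<close>

definition visit :: "nat \<Rightarrow> nat \<Rightarrow> com" where
  "visit F G = Basic (Get V_x G V_p) \<Zsemi> Basic (Get V_r A_index V_x) \<Zsemi>
     If (Less V_r V_p)
       (Basic (Get V_t F V_r) \<Zsemi>
        If (Equal V_t V_b)
          (Basic (Get V_t G V_r) \<Zsemi> If (Equal V_t V_x) Skip (Basic (Copy V_r V_p)))
          (Basic (Copy V_r V_p)))
       (Basic (Copy V_r V_p)) \<Zsemi>
     If (Equal V_r V_p) (Basic (Put A_index V_x V_p) \<Zsemi> Basic (Put A_count V_p V_zero)) Skip \<Zsemi>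
     Basic (Put A_meet V_p V_r) \<Zsemi> Basic (Get V_t A_count V_r) \<Zsemi>
     Basic (Plus V_t V_t V_one) \<Zsemi> Basic (Put A_count V_r V_t) \<Zsemi> Basic (Get V_p A_next V_p)"

definition advance :: "nat \<Rightarrow> com" where
  "advance F = Basic (Plus V_b V_b V_one) \<Zsemi>
     If (Less V_b V_len)
       (Basic (Get V_t F V_b) \<Zsemi> If (Equal V_t V_b) (Basic (Copy V_p V_b)) Skip) Skip"

definition group :: "nat \<Rightarrow> nat \<Rightarrow> com" where
  "group F G = Basic (Assign V_b 0) \<Zsemi> Basic (Assign V_p 0) \<Zsemi>
     While (Less V_b V_len) (If (Less V_p V_len) (visit F G) (advance F))"

definition refine :: "nat \<Rightarrow> nat \<Rightarrow> com" where
  "refine F G = link F \<Zsemi> group F G"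

lemma changes_refine:
  "vars (refine F G) = {V_i, V_x, V_r, V_t, V_c, V_b, V_p}"
  "arrs (refine F G) = {A_first, A_next, A_index, A_count, A_meet}"
  by (auto simp: refine_def link_def link_step_def group_def visit_def advance_def)

section \<open>Correctness and linear time of a refinement\<close>

locale positions = array_machine n 13 M for n M +
  fixes N :: nat
  assumes N: "0 < N" "N \<le> n" "2 * n < M"
begin

text \<open>Temporaries carry nothing from one iteration to the next, so \<open>I\<close> speaks of
  arrays only. The body recovers the values it depends on from the frame equations for
  \<open>v0\<close> and \<open>a0\<close>.\<close>

lemma triple_for_loop:
  assumes "v0 V_len = N" "v0 V_one = 1" and fresh: "V_i \<notin> vars c" "V_len \<notin> vars c" "V_one \<notin> vars c"
    and "I 0 a0"
    and step: "\<And>i v a. \<lbrakk>i < N; v V_i = i; \<And>x. x \<notin> vars c \<Longrightarrow> x \<noteq> V_i \<Longrightarrow> v x = v0 x;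
      \<And>A. A \<notin> arrs c \<Longrightarrow> a A = a0 A; I i a\<rbrakk> \<Longrightarrow> wp c (\<lambda>(v', a'). I (Suc i) a') (v, a)"
  shows "triple (for_loop c) (N * (cost c + 4) + 4) (v0, a0) (\<lambda>(v, a). I N a)"
proof -
  let ?c = "c \<Zsemi> Basic (Plus V_i V_i V_one)"
  let ?I = "\<lambda>(v, a). v V_i \<le> N \<and> I (v V_i) a"
  have "triple (While (Less V_i V_len) ?c) (N * (cost c + 2 + 2) + 2) (v0(V_i := 0), a0)
    (\<lambda>(v, a). I N a)"
  proof (rule triple_While[where I = ?I and f = "\<lambda>(v, a). N - v V_i"])
    show "?I (v0(V_i := 0), a0)" using assms by simp
  next
    fix v a
    assume same: "same_outside ?c (v0(V_i := 0), a0) (v, a)" and "?I (v, a)"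
      and "holds (Less V_i V_len) (v, a)"
    then have same_v: "\<And>x. x \<notin> vars c \<Longrightarrow> x \<noteq> V_i \<Longrightarrow> v x = v0 x"
      and same_a: "\<And>A. A \<notin> arrs c \<Longrightarrow> a A = a0 A"
      by (auto simp: same_outside_def)
    have i: "v V_i < N" "I (v V_i) a"
      using \<open>?I (v, a)\<close> \<open>holds (Less V_i V_len) (v, a)\<close> same_v[OF fresh(2)] assms(1) by auto
    have "triple c (cost c) (v, a) (\<lambda>(v', a'). I (Suc (v V_i)) a')"
      by (intro triple_wp step i same_v same_a) auto
    then have "triple ?c (cost c + cost (Basic (Plus V_i V_i V_one))) (v, a)
      (\<lambda>s'. ?I s' \<and> (case s' of (v, a) \<Rightarrow> N - v V_i) < N - v V_i)"
    proof (rule triple_Seq)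
      fix v' a'
      assume 1: "same_outside c (v, a) (v', a')" "case (v', a') of (v', a') \<Rightarrow> I (Suc (v V_i)) a'"
      then have "v' V_i = v V_i" "v' V_one = 1"
        using fresh same_v[OF fresh(3)] assms(2) by (auto simp: same_outside_def)
      then show "triple (Basic (Plus V_i V_i V_one)) (cost (Basic (Plus V_i V_i V_one))) (v', a')
          (\<lambda>s'. ?I s' \<and> (case s' of (v, a) \<Rightarrow> N - v V_i) < N - v V_i)"
        using 1(2) i N by (intro triple_wp) auto
    qed
    then show "triple ?c (cost c + 2) (v, a)
      (\<lambda>s'. ?I s' \<and> (case s' of (v, a) \<Rightarrow> N - v V_i) < (case (v, a) of (v, a) \<Rightarrow> N - v V_i))"
      by simp
  next
    fix v a
    assume "same_outside ?c (v0(V_i := 0), a0) (v, a)" "?I (v, a)" "\<not> holds (Less V_i V_len) (v, a)"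
    moreover from this have "v V_len = N" using assms(1) fresh(2) by (auto simp: same_outside_def)
    ultimately show "case (v, a) of (v, a) \<Rightarrow> I N a" by auto
  qed simp
  then have "triple (for_loop c) (2 + (N * (cost c + 2 + 2) + 2)) (v0, a0) (\<lambda>(v, a). I N a)"
    unfolding for_loop_def
    using triple_wp[of "Basic (Assign V_i 0)" "\<lambda>s. s = (v0(V_i := 0), a0)" "(v0, a0)"] N
    by (intro triple_Seq[where Q = "\<lambda>s. s = (v0(V_i := 0), a0)"]) auto
  then show ?thesis by (rule triple_weaken) (auto simp: algebra_simps)
qed

lemma triple_link:
  assumes f: "canonical f" "\<And>i. i < N \<Longrightarrow> a0 F i = f i" "F < 13" "F \<noteq> A_first" "F \<noteq> A_next"
    and v0: "v0 V_len = N" "v0 V_one = 1" "v0 V_zero = 0"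
  shows "triple (link F) (28 * N + 4) (v0, a0) (\<lambda>(v, a). \<forall>p<N. next_in_class N f p (a A_next p))"
proof -
  have cost: "cost (link_step F) = 22" by (simp add: link_step_def)
  have vars: "vars (link_step F) = {V_i, V_x, V_r, V_t, V_c}"
    "arrs (link_step F) = {A_first, A_next}"
    by (auto simp: link_step_def)
  let ?I = "\<lambda>(v, a). linking N f (v V_i) (a A_first) (a A_next)"
  have "triple (While (Less V_zero V_i) (link_step F)) (N * (22 + 2) + 2) (v0(V_i := N), a0)
    (\<lambda>(v, a). \<forall>p<N. next_in_class N f p (a A_next p))"
  proof (rule triple_While[where I = ?I and f = "\<lambda>(v, a). v V_i"])
    show "?I (v0(V_i := N), a0)" by (auto simp: linking_def)
  next
    fix v a
    assume same: "same_outside (link_step F) (v0(V_i := N), a0) (v, a)" and I: "?I (v, a)"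
      and holds: "holds (Less V_zero V_i) (v, a)"
    have same_v: "v V_len = N" "v V_one = 1" "v V_zero = 0" "a F = a0 F"
      using same assms by (auto simp: same_outside_def vars)
    then obtain i where i: "v V_i = Suc i" using holds by (cases "v V_i") auto
    have "i < N" using I i by (simp add: linking_def)
    have fi: "a F i = f i" "f i < n" using \<open>i < N\<close> same_v f(1,2) N
      by (auto simp: canonical_def intro: le_less_trans)
    define t where "t = (if i < a A_first (f i) \<and> a A_first (f i) < N \<and> f (a A_first (f i)) = f i
      then a A_first (f i) else N)"
    have step: "linking N f i ((a A_first)(f i := i)) ((a A_next)(i := t))"
      using linking_step[of N f i "a A_first" "a A_next", OF _ t_def] I i by simp
    have F: "\<And>j. j < N \<Longrightarrow> a F j = f j" using same_v f(2) by simp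
    have "wp (link_step F) (\<lambda>s'. ?I s' \<and> (case s' of (v, a) \<Rightarrow> v V_i) < Suc i) (v, a)"
    proof (cases "i < a A_first (f i) \<and> a A_first (f i) < N \<and> f (a A_first (f i)) = f i")
      case True
      then show ?thesis
        using step \<open>i < N\<close> fi F f(3-5) N unfolding link_step_def t_def by (simp add: i same_v)
    next
      case False
      then show ?thesis
        using step \<open>i < N\<close> fi F f(3-5) N unfolding link_step_def t_def by (auto simp: i same_v)
    qed
    then show "triple (link_step F) 22 (v, a)
      (\<lambda>s'. ?I s' \<and> (case s' of (v, a) \<Rightarrow> v V_i) < (case (v, a) of (v, a) \<Rightarrow> v V_i))"
      using triple_wp[of "link_step F"] i cost by auto
  next
    fix v a
    assume same: "same_outside (link_step F) (v0(V_i := N), a0) (v, a)" and I: "?I (v, a)"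
      and "\<not> holds (Less V_zero V_i) (v, a)"
    then have "v V_i = 0" using assms by (auto simp: same_outside_def vars)
    then show "case (v, a) of (v, a) \<Rightarrow> \<forall>p<N. next_in_class N f p (a A_next p)"
      using I by (simp add: linking_def)
  qed simp
  then have "triple (link F) (2 + (N * (22 + 2) + 2)) (v0, a0)
      (\<lambda>(v, a). \<forall>p<N. next_in_class N f p (a A_next p))"
    unfolding link_def
    using triple_wp[of "Basic (Copy V_i V_len)" "\<lambda>s. s = (v0(V_i := N), a0)" "(v0, a0)"] v0
    by (intro triple_Seq[where Q = "\<lambda>s. s = (v0(V_i := N), a0)"]) auto
  then show ?thesis by (rule triple_weaken) auto
qed

lemma wp_visit:
  assumes f: "\<And>i. i < N \<Longrightarrow> a F i = f i" "F < 13" "F \<notin> {A_first, A_next, A_index, A_count, A_meet}"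
    and g: "\<And>i. i < N \<Longrightarrow> a G i = g i" "\<And>i. i < N \<Longrightarrow> g i < n" "G < 13"
      "G \<notin> {A_first, A_next, A_index, A_count, A_meet}"
    and v: "v V_len = N" "v V_one = 1" "v V_zero = 0" "v V_b = b" "v V_p = p" "p < N"
    and nx: "next_in_class N f p (a A_next p)"
    and inv: "grouping N f g b p (a A_meet) (a A_count) (a A_index)"
  shows "wp (visit F G) (\<lambda>(v', a'). v' V_b = b \<and> v' V_p = a A_next p \<and>
    grouping N f g b (a A_next p) (a' A_meet) (a' A_count) (a' A_index)) (v, a)"
proof -
  define r where "r = meet f g p"
  define ct where "ct = (if r = p then (a A_count)(p := 0) else a A_count)"
  define idx where "idx = (if r = p then (a A_index)(g p := p) else a A_index)"
  have "r \<le> p" using meet_le[of f p p g] by (simp add: r_def)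
  have step: "grouping N f g b (a A_next p) ((a A_meet)(p := r)) (ct(r := Suc (ct r))) idx"
    using grouping_visit[OF inv v(6) nx] by (simp add: r_def ct_def idx_def)
  have fp: "f p = b" using inv v(6) by (simp add: grouping_def)
  \<comment> \<open>For the safety of the increment: the counter is either freshly reset or counts
    visited positions, among which \<open>p\<close> is not yet.\<close>
  have ct_r: "ct r < n"
  proof (cases "r = p")
    case True
    then show ?thesis using N by (simp add: ct_def)
  next
    case False
    then have r: "r < p" "f r = b" "meet f g r = r" "r < N"
      using \<open>r \<le> p\<close> meet_same[of f g p] fp v(6) meet_idem[of f g p] by (auto simp: r_def)
    then have "visited f b p r" by (simp add: visited_def)
    moreover have "\<forall>i<N. visited f b p i \<longrightarrow> meet f g i = i \<longrightarrow>
        a A_count i = card {j. j < N \<and> visited f b p j \<and> f j = f i \<and> g j = g i}"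
      using inv unfolding grouping_def by blast
    ultimately have "ct r = card {j. j < N \<and> visited f b p j \<and> f j = f r \<and> g j = g r}"
      using r False by (simp add: ct_def)
    also have "\<dots> \<le> card ({..<N} - {p})"
      by (rule card_mono) (auto simp: visited_def fp)
    also have "\<dots> < n" using v(6) N by simp
    finally show ?thesis .
  qed
  have cand: "r = (if a A_index (g p) < p \<and> f (a A_index (g p)) = b \<and>
      g (a A_index (g p)) = g p then a A_index (g p) else p)"
    using candidate_eq_meet[OF inv v(6)] by (simp add: r_def)
  have bounds: "p < n" "g p < n" "a G p = g p" using v(6) N g(1,2) by simp_all
  \<comment> \<open>The outcomes of the tests in terms of the array contents. These may be
    identified with \<open>f\<close> and \<open>g\<close> only at indices known to be below
    \<open>N\<close>, which explains the split on \<open>a A_index (g p) < p\<close>.\<close>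
  consider (old) "a A_index (g p) < p" "a F (a A_index (g p)) = b" "a G (a A_index (g p)) = g p"
      "r = a A_index (g p)"
    | (new) "\<not> (a A_index (g p) < p \<and> a F (a A_index (g p)) = b \<and> a G (a A_index (g p)) = g p)"
      "r = p"
  proof (cases "a A_index (g p) < p")
    case True
    then have "a F (a A_index (g p)) = f (a A_index (g p))" "a G (a A_index (g p)) = g (a A_index (g p))"
      using f(1) g(1) v(6) by simp_all
    then show ?thesis using that cand by presburger
  next
    case False
    then show ?thesis using that(2) cand by presburger
  qed
  then show ?thesis
  proof cases
    case old
    then have "ct = a A_count" "idx = a A_index" by (simp_all add: ct_def idx_def)
    moreover have "a A_index (g p) < n" using old(1) v(6) N by linarith
    ultimately show ?thesis
      using old step ct_r f(2,3) bounds g(3,4) v N unfolding visit_def by simp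
  next
    case new
    then have "ct = (a A_count)(p := 0)" "idx = (a A_index)(g p := p)"
      by (simp_all add: ct_def idx_def)
    moreover have "a A_index (g p) < n" if "a A_index (g p) < p" using that v(6) N by linarith
    moreover have M: "Suc 0 < M" using N by simp
    ultimately show ?thesis
      using new step ct_r f(2,3) bounds g(3,4) v N unfolding visit_def by (simp add: M)
  qed
qed

lemma triple_group:
  assumes f: "canonical f" "\<And>i. i < N \<Longrightarrow> a0 F i = f i" "F < 13"
      "F \<notin> {A_first, A_next, A_index, A_count, A_meet}"
    and g: "\<And>i. i < N \<Longrightarrow> a0 G i = g i" "\<And>i. i < N \<Longrightarrow> g i < n" "G < 13"
      "G \<notin> {A_first, A_next, A_index, A_count, A_meet}"
    and v0: "v0 V_len = N" "v0 V_one = 1" "v0 V_zero = 0"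
    and nx: "\<forall>p<N. next_in_class N f p (a0 A_next p)"
  shows "triple (group F G) (100 * N + 6) (v0, a0) (\<lambda>(v, a). \<forall>i<N. a A_meet i = meet f g i \<and>
    (meet f g i = i \<longrightarrow> a A_count i = card {j. j < N \<and> f j = f i \<and> g j = g i}))"
    (is "triple _ _ _ ?Q")
proof -
  let ?c = "If (Less V_p V_len) (visit F G) (advance F)"
  have cost: "cost ?c \<le> 48" by (simp add: visit_def advance_def)
  have vars: "vars ?c = {V_x, V_r, V_t, V_b, V_p}" "arrs ?c = {A_index, A_count, A_meet}"
    by (auto simp: visit_def advance_def)
  let ?s = "(v0(V_b := 0, V_p := 0), a0)"
  let ?I = "\<lambda>(v, a). grouping N f g (v V_b) (v V_p) (a A_meet) (a A_count) (a A_index)"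
  let ?f = "\<lambda>(v, a). unvisited N f (v V_b) (v V_p)"
  have "triple (While (Less V_b V_len) ?c) ((2 * N) * (48 + 2) + 2) ?s ?Q"
  proof (rule triple_While[where I = ?I and f = ?f])
    show "?I ?s" using grouping_start[OF f(1)] by simp
    show "?f ?s \<le> 2 * N" using unvisited_le by simp
  next
    fix v a
    assume same: "same_outside ?c ?s (v, a)" and I: "?I (v, a)"
      and holds: "holds (Less V_b V_len) (v, a)"
    have same_v: "v V_len = N" "v V_one = 1" "v V_zero = 0" "a F = a0 F" "a G = a0 G"
      "a A_next = a0 A_next"
      using same[unfolded same_outside_def vars] assms by auto
    have I': "grouping N f g (v V_b) (v V_p) (a A_meet) (a A_count) (a A_index)" using I by simp
    have "wp ?c (\<lambda>s'. ?I s' \<and> ?f s' < ?f (v, a)) (v, a)"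
    proof (cases "v V_p < N")
      case True
      have nx': "next_in_class N f (v V_p) (a A_next (v V_p))" using nx True same_v by simp
      have less: "unvisited N f (v V_b) (a A_next (v V_p)) < unvisited N f (v V_b) (v V_p)"
        using I' True nx' by (intro unvisited_visit) (auto simp: grouping_def)
      have "wp (visit F G) (\<lambda>(v', a'). v' V_b = v V_b \<and> v' V_p = a A_next (v V_p) \<and>
        grouping N f g (v V_b) (a A_next (v V_p)) (a' A_meet) (a' A_count) (a' A_index)) (v, a)"
        using f g same_v True nx' I' by (intro wp_visit) auto
      then have "wp (visit F G) (\<lambda>s'. ?I s' \<and> ?f s' < ?f (v, a)) (v, a)"
        by (rule wp_mono) (use less in auto)
      then show ?thesis using True same_v by simp
    next
      case False
      define b where "b = v V_b"
      define q where "q = (if f (Suc b) = Suc b \<and> Suc b < N then Suc b else N)"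
      have b: "b < N" "v V_b = b" using holds same_v by (auto simp: b_def)
      have p: "v V_p = N" using I' False by (simp add: grouping_def)
      have I'': "grouping N f g b N (a A_meet) (a A_count) (a A_index)" using I' p b by simp
      note step = grouping_advance[OF f(1) I'' b(1) q_def] unvisited_advance[OF f(1) b(1) q_def]
      have "a F (Suc b) = f (Suc b)" if "Suc b < N" using that same_v f(2) by simp
      then show ?thesis
        using step b p same_v f(3,4) N unfolding advance_def q_def
        by (simp add: False split: if_splits)
    qed
    from triple_wp[OF this] show "triple ?c 48 (v, a) (\<lambda>s'. ?I s' \<and> ?f s' < ?f (v, a))"
      using cost by (rule triple_weaken)
  next
    fix v a
    assume same: "same_outside ?c ?s (v, a)" and I: "?I (v, a)"
      and holds: "\<not> holds (Less V_b V_len) (v, a)"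
    have "v V_len = N" using same[unfolded same_outside_def vars] v0 by auto
    then have "v V_b = N" using I holds by (simp add: grouping_def)
    then have "grouping N f g N (v V_p) (a A_meet) (a A_count) (a A_index)" using I by simp
    then show "?Q (v, a)" using grouping_end[OF f(1)] by simp
  qed
  then have "triple (group F G) (2 + (2 + ((2 * N) * (48 + 2) + 2))) (v0, a0) ?Q"
    unfolding group_def
    using triple_wp[of "Basic (Assign V_b 0)" "\<lambda>s. s = (v0(V_b := 0), a0)" "(v0, a0)"]
      triple_wp[of "Basic (Assign V_p 0)" "\<lambda>s. s = ?s" "(v0(V_b := 0), a0)"] N
    by (intro triple_Seq[where Q = "\<lambda>s. s = ?s"] triple_Seq[where Q = "\<lambda>s. s = (v0(V_b := 0), a0)"])
      auto
  then show ?thesis by (rule triple_weaken) auto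
qed

lemma triple_refine:
  assumes f: "canonical f" "\<And>i. i < N \<Longrightarrow> a0 F i = f i" "F < 13"
      "F \<notin> {A_first, A_next, A_index, A_count, A_meet}"
    and g: "\<And>i. i < N \<Longrightarrow> a0 G i = g i" "\<And>i. i < N \<Longrightarrow> g i < n" "G < 13"
      "G \<notin> {A_first, A_next, A_index, A_count, A_meet}"
    and v0: "v0 V_len = N" "v0 V_one = 1" "v0 V_zero = 0"
  shows "triple (refine F G) (138 * N) (v0, a0) (\<lambda>(v, a). \<forall>i<N. a A_meet i = meet f g i \<and>
    (meet f g i = i \<longrightarrow> a A_count i = card {j. j < N \<and> f j = f i \<and> g j = g i}))"
    (is "triple _ _ _ ?Q")
proof -
  have vars: "vars (link F) = {V_i, V_x, V_r, V_t, V_c}" "arrs (link F) = {A_first, A_next}"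
    by (auto simp: link_def link_step_def)
  have "triple (link F) (28 * N + 4) (v0, a0) (\<lambda>(v, a). \<forall>p<N. next_in_class N f p (a A_next p))"
    using f v0 by (intro triple_link) auto
  then have "triple (refine F G) ((28 * N + 4) + (100 * N + 6)) (v0, a0) ?Q"
    unfolding refine_def
  proof (rule triple_Seq)
    fix v a
    assume "same_outside (link F) (v0, a0) (v, a)"
      and "case (v, a) of (v, a) \<Rightarrow> \<forall>p<N. next_in_class N f p (a A_next p)"
    then show "triple (group F G) (100 * N + 6) (v, a) ?Q"
      using f g v0 by (intro triple_group) (auto simp: same_outside_def vars)
  qed
  \<comment> \<open>The additive constant in \<open>128 * N + 10\<close> is absorbed by
    \<open>0 < N\<close>.\<close>
  then show ?thesis by (rule triple_weaken) (use N in auto)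
qed

end

section \<open>Partitions of the positions by parts of the factors\<close>

text \<open>Parts of factors are given by sets of offsets, so that prefixes \<open>{..<k}\<close>,
  suffixes \<open>{k..<m}\<close> and factors with one offset left out are treated alike, and common
  refinement becomes union of offset sets (\<open>meet_rep\<close>).\<close>

definition agree :: "(nat \<Rightarrow> nat) \<Rightarrow> nat set \<Rightarrow> nat \<Rightarrow> nat \<Rightarrow> bool" where
  "agree y T i j \<longleftrightarrow> (\<forall>t\<in>T. y (i + t) = y (j + t))"

definition rep :: "(nat \<Rightarrow> nat) \<Rightarrow> nat set \<Rightarrow> nat \<Rightarrow> nat" where
  "rep y T i = (LEAST j. agree y T j i)"

lemma agree_refl [simp]: "agree y T i i"
  by (simp add: agree_def)

lemma agree_sym: "agree y T i j \<Longrightarrow> agree y T j i"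
  by (simp add: agree_def)

lemma agree_trans: "agree y T i j \<Longrightarrow> agree y T j k \<Longrightarrow> agree y T i k"
  by (simp add: agree_def)

lemma agree_Un: "agree y (S \<union> T) i j \<longleftrightarrow> agree y S i j \<and> agree y T i j"
  by (auto simp: agree_def)

lemma agree_rep: "agree y T (rep y T i) i"
  unfolding rep_def by (rule LeastI[where k = i]) simp

lemma rep_le: "rep y T i \<le> i"
  unfolding rep_def by (rule Least_le) simp

lemma rep_eq_iff: "rep y T i = rep y T j \<longleftrightarrow> agree y T i j"
proof
  assume "rep y T i = rep y T j"
  then show "agree y T i j" using agree_rep[of y T i] agree_rep[of y T j]
    by (metis agree_sym agree_trans)
next
  assume "agree y T i j"
  then have "agree y T k i \<longleftrightarrow> agree y T k j" for k by (metis agree_sym agree_trans)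
  then show "rep y T i = rep y T j" by (simp add: rep_def)
qed

lemma rep_rep: "rep y T (rep y T i) = rep y T i"
  by (simp add: rep_eq_iff agree_rep)

lemma canonical_rep: "canonical (rep y T)"
  by (simp add: canonical_def rep_le rep_rep)

lemma rep_empty [simp]: "rep y {} i = 0"
  by (simp add: rep_def agree_def)

lemma meet_rep: "meet (rep y S) (rep y T) i = rep y (S \<union> T) i"
  by (simp add: meet_def rep_eq_iff agree_Un) (simp add: rep_def agree_Un)

lemma meet_rep_letter: "meet (rep y T) (\<lambda>i. y (i + k)) i = rep y (T \<union> {k}) i"
  by (simp add: meet_def rep_eq_iff) (simp add: rep_def agree_Un agree_def conj_commute)

text \<open>\<open>time r\<close> and \<open>parent r\<close> tell when \<open>r\<close> became a representative and by which position it was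
  represented before, so the partitions by prefixes can be recomputed in the reverse order.\<close>

definition recorded :: "nat \<Rightarrow> (nat \<Rightarrow> nat) \<Rightarrow> nat \<Rightarrow> (nat \<Rightarrow> nat) \<Rightarrow> (nat \<Rightarrow> nat) \<Rightarrow> bool" where
  "recorded N y k time parent \<longleftrightarrow> (\<forall>r<N. time r \<le> k) \<and>
     (\<forall>j<k. \<forall>r<N. rep y {..<Suc j} r = r \<longrightarrow>
        rep y {..<j} r = (if time r = Suc j then parent r else r))"

text \<open>The entries of a position may change in every round until it becomes a representative.
  From then on it represents itself in all later partitions, so its entries are frozen and still
  describe that moment.\<close>

lemma recorded_Suc:
  assumes "recorded N y k time parent"
    and time': "\<And>i. i < N \<Longrightarrow> time' i =
      (if rep y {..<k} i = rep y {..<Suc k} i then time i else Suc k)"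
    and parent': "\<And>i. i < N \<Longrightarrow> parent' i =
      (if rep y {..<k} i = rep y {..<Suc k} i then parent i else rep y {..<k} i)"
  shows "recorded N y (Suc k) time' parent'"
  unfolding recorded_def
proof (intro conjI allI impI)
  fix r assume "r < N"
  then show "time' r \<le> Suc k" using assms(1) time' by (auto simp: recorded_def le_SucI)
next
  fix j r
  assume j: "j < Suc k" and r: "r < N" "rep y {..<Suc j} r = r"
  show "rep y {..<j} r = (if time' r = Suc j then parent' r else r)"
  proof (cases "j = k")
    case True
    \<comment> \<open>Old stamps are at most \<open>k\<close>, so the stamp \<open>Suc k\<close>
      marks exactly the changes of this round.\<close>
    have "time r \<noteq> Suc k" using assms(1) r(1) unfolding recorded_def by fastforce
    then show ?thesis using True time'[OF r(1)] parent'[OF r(1)] r(2) by auto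
  next
    case False
    \<comment> \<open>Agreement on more letters implies agreement on fewer, so a least element stays
      least when classes shrink.\<close>
    have stays: "rep y {..<l} r = r" if "Suc j \<le> l" for l
    proof (rule antisym[OF rep_le])
      have "agree y {..<Suc j} (rep y {..<l} r) r"
        using agree_rep[of y "{..<l}" r] that by (auto simp: agree_def)
      then have "rep y {..<Suc j} (rep y {..<l} r) = r" using r(2) rep_eq_iff by metis
      then show "r \<le> rep y {..<l} r" using rep_le[of y "{..<Suc j}" "rep y {..<l} r"] by simp
    qed
    have "time' r = time r" "parent' r = parent r"
      using stays[of k] stays[of "Suc k"] j False time'[OF r(1)] parent'[OF r(1)] by auto
    then show ?thesis using assms(1) j False r unfolding recorded_def by simp
  qed
qed

text \<open>A position and its finer representative \<open>?r\<close> agree on the first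
  \<open>k\<close> letters too, so they share the coarser representative, and that one can be read
  off from the entries of \<open>?r\<close>.\<close>

lemma recorded_back:
  assumes "recorded N y m time parent" "k < m" "i < N"
  shows "rep y {..<k} i = (if time (rep y {..<Suc k} i) = Suc k
    then parent (rep y {..<Suc k} i) else rep y {..<Suc k} i)"
proof -
  let ?r = "rep y {..<Suc k} i"
  have "?r < N" using rep_le[of y "{..<Suc k}" i] assms(3) by simp
  then have "rep y {..<k} ?r = (if time ?r = Suc k then parent ?r else ?r)"
    using assms(1,2) rep_rep unfolding recorded_def by simp
  moreover have "rep y {..<k} ?r = rep y {..<k} i"
    using agree_rep[of y "{..<Suc k}" i] by (auto simp: rep_eq_iff agree_def)
  ultimately show ?thesis by simp
qed

text \<open>The positions whose only mismatch with \<open>i\<close> is at an offset from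
  \<open>k\<close> on. Its cardinality is the content of the result array once the offsets from
  \<open>k\<close> to \<open>m - 1\<close> have been processed.\<close>

definition near :: "nat \<Rightarrow> (nat \<Rightarrow> nat) \<Rightarrow> nat \<Rightarrow> nat \<Rightarrow> nat \<Rightarrow> nat set" where
  "near N y m k i = {j. j < N \<and> (\<exists>t. k \<le> t \<and> t < m \<and> agree y ({..<m} - {t}) j i \<and>
     y (j + t) \<noteq> y (i + t))}"

abbreviation class_size :: "nat \<Rightarrow> (nat \<Rightarrow> nat) \<Rightarrow> nat set \<Rightarrow> nat \<Rightarrow> nat" where
  "class_size N y T i \<equiv> card {j. j < N \<and> agree y T j i}"

lemma finite_near: "finite (near N y m k i)"
  by (simp add: near_def)

lemma card_near_le: "card (near N y m k i) \<le> N"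
proof -
  have "card (near N y m k i) \<le> card {..<N}" by (rule card_mono) (auto simp: near_def)
  then show ?thesis by simp
qed

lemma class_size_mono: "S \<subseteq> T \<Longrightarrow> class_size N y T i \<le> class_size N y S i"
  by (rule card_mono) (auto simp: agree_def)

lemma class_size_cong:
  assumes "agree y T i i'"
  shows "class_size N y T i = class_size N y T i'"
proof -
  have "{j. j < N \<and> agree y T j i} = {j. j < N \<and> agree y T j i'}"
    using assms by (metis agree_sym agree_trans)
  then show ?thesis by simp
qed

lemma class_size_le: "class_size N y T i \<le> N"
proof -
  have "class_size N y T i \<le> card {..<N}" by (rule card_mono) auto
  then show ?thesis by simp
qed

text \<open>A sole mismatch at \<open>k\<close> means agreement everywhere except at
  \<open>k\<close> without agreement everywhere. The second class is contained in the first, so the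
  difference of the sizes is exact; and no position is counted for two offsets, since its mismatch
  is unique.\<close>

lemma near_Suc:
  assumes "k < m"
  shows "card (near N y m k i) = card (near N y m (Suc k) i) +
    (class_size N y ({..<k} \<union> {Suc k..<m}) i - class_size N y {..<m} i)"
proof -
  let ?U = "{..<k} \<union> {Suc k..<m}"
  let ?A = "{j. j < N \<and> agree y ?U j i}" and ?B = "{j. j < N \<and> agree y {..<m} j i}"
  have U: "?U = {..<m} - {k}" using assms by auto
  have m: "{..<m} = ?U \<union> {k}" using assms by auto
  have D: "?A - ?B = {j. j < N \<and> agree y ({..<m} - {k}) j i \<and> y (j + k) \<noteq> y (i + k)}"
    unfolding U[symmetric] by (subst m) (auto simp: agree_Un, auto simp: agree_def)
  have split: "(\<exists>t. k \<le> t \<and> t < m \<and> P t) \<longleftrightarrow> P k \<or> (\<exists>t. Suc k \<le> t \<and> t < m \<and> P t)" for P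
    using assms by (metis Suc_leD Suc_leI le_neq_implies_less order_refl)
  have "near N y m k i = near N y m (Suc k) i \<union> (?A - ?B)"
    unfolding D near_def split by blast
  moreover have "near N y m (Suc k) i \<inter> (?A - ?B) = {}"
    unfolding D near_def using assms by (auto simp: agree_def)
  ultimately have "card (near N y m k i) = card (near N y m (Suc k) i) + card (?A - ?B)"
    by (simp add: card_Un_disjoint finite_near)
  moreover have "card (?A - ?B) = card ?A - card ?B"
    by (rule card_Diff_subset) (use assms in \<open>auto simp: agree_def\<close>)
  ultimately show ?thesis by simp
qed

lemma near_end: "near N y m m i = {}"
  by (auto simp: near_def)

lemma hamming_dist_factor:
  assumes "1 \<le> m"
  shows "hamming_dist (factor x i (i + m - 1)) (factor x j (j + m - 1)) =
    card {t. t < m \<and> x ! (i + t) \<noteq> x ! (j + t)}"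
proof -
  have "[i..<Suc (i + m - 1)] = [i..<i + m]" "[j..<Suc (j + m - 1)] = [j..<j + m]"
    using assms by simp_all
  then show ?thesis
    unfolding hamming_dist_def factor_def by (auto intro!: arg_cong[of _ _ card])
qed

text \<open>Distance 1 means that the set of mismatches is a singleton. Letters are at least 1, so
  truncated subtraction of 1 is injective on them and preserves mismatches.\<close>

lemma one_mappability_near:
  assumes "set x \<subseteq> {1..length x}" "1 \<le> m" "m < length x" "i < length x - m + 1"
  shows "one_mappability x m ! i = card (near (length x - m + 1) (\<lambda>p. x ! p - 1) m 0 i)"
proof -
  let ?N = "length x - m + 1"
  have pos: "x ! p - 1 = x ! q - 1 \<longleftrightarrow> x ! p = x ! q" if "p < length x" "q < length x" for p q
  proof -
    have "1 \<le> x ! p" "1 \<le> x ! q" using assms(1) that nth_mem by fastforce+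
    then show ?thesis by arith
  qed
  have "hamming_dist (factor x i (i + m - 1)) (factor x j (j + m - 1)) = 1 \<longleftrightarrow>
    j \<in> near ?N (\<lambda>p. x ! p - 1) m 0 i" if "j < ?N" for j
  proof -
    have eq: "x ! (j + t) - 1 = x ! (i + t) - 1 \<longleftrightarrow> x ! (i + t) = x ! (j + t)" if "t < m" for t
      using pos[of "j + t" "i + t"] assms \<open>j < ?N\<close> that by auto
    have "hamming_dist (factor x i (i + m - 1)) (factor x j (j + m - 1)) = 1 \<longleftrightarrow>
      (\<exists>t. {t. t < m \<and> x ! (i + t) \<noteq> x ! (j + t)} = {t})"
      unfolding hamming_dist_factor[OF assms(2)] unfolding One_nat_def by (rule card_1_singleton_iff)
    also have "\<dots> \<longleftrightarrow> (\<exists>t<m. x ! (i + t) \<noteq> x ! (j + t) \<and>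
        (\<forall>u\<in>{..<m} - {t}. x ! (i + u) = x ! (j + u)))"
      by (rule iff_exI) auto
    also have "\<dots> \<longleftrightarrow> j \<in> near ?N (\<lambda>p. x ! p - 1) m 0 i"
      using that eq by (auto simp: near_def agree_def)
    finally show ?thesis .
  qed
  then have "{j \<in> {0..length x - m}. hamming_dist (factor x i (i + m - 1)) (factor x j (j + m - 1)) = 1} =
      near ?N (\<lambda>p. x ! p - 1) m 0 i"
    by (auto simp: near_def)
  then show ?thesis using assms(4) unfolding one_mappability_def by (simp del: upt_Suc)
qed

section \<open>The algorithm\<close>

text \<open>The shift by one turns letters from \<open>{1..n}\<close> into valid indices of an array
  with \<open>n\<close> cells.\<close>

definition load_key :: com where
  "load_key = Basic (Plus V_t V_i V_k) \<Zsemi> Basic (Get V_t A_text V_t) \<Zsemi>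
     Basic (Minus V_t V_t V_one) \<Zsemi> Basic (Put A_key V_i V_t)"

definition record_change :: com where
  "record_change = Basic (Get V_r A_prefix V_i) \<Zsemi> Basic (Get V_t A_meet V_i) \<Zsemi>
     If (Equal V_r V_t) Skip (Basic (Put A_time V_i V_k') \<Zsemi> Basic (Put A_parent V_i V_r)) \<Zsemi>
     Basic (Put A_prefix V_i V_t)"

definition grow_step :: com where
  "grow_step = for_loop load_key \<Zsemi> refine A_prefix A_key \<Zsemi> Basic (Plus V_k' V_k V_one) \<Zsemi>
     for_loop record_change \<Zsemi> Basic (Copy V_k V_k')"

definition grow :: com where
  "grow = Basic (Assign V_k 0) \<Zsemi> While (Less V_k V_m) grow_step"

definition load_size :: com where
  "load_size = Basic (Get V_r A_prefix V_i) \<Zsemi> Basic (Get V_t A_count V_r) \<Zsemi>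
     Basic (Put A_equal V_i V_t)"

definition undo_change :: com where
  "undo_change = Basic (Get V_r A_prefix V_i) \<Zsemi> Basic (Get V_t A_time V_r) \<Zsemi>
     If (Equal V_t V_k') (Basic (Get V_r A_parent V_r)) Skip \<Zsemi> Basic (Put A_prefix V_i V_r)"

definition add_sizes :: com where
  "add_sizes = Basic (Get V_r A_meet V_i) \<Zsemi> Basic (Get V_t A_count V_r) \<Zsemi>
     Basic (Get V_c A_equal V_i) \<Zsemi> Basic (Minus V_t V_t V_c) \<Zsemi>
     Basic (Get V_c A_result V_i) \<Zsemi> Basic (Plus V_c V_c V_t) \<Zsemi> Basic (Put A_result V_i V_c)"

definition store_suffix :: com where
  "store_suffix = Basic (Get V_t A_meet V_i) \<Zsemi> Basic (Put A_suffix V_i V_t)"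

text \<open>The suffix partition is used before it is extended by the letter at offset
  \<open>V_k\<close>, so the first refinement combines the offsets below and above
  \<open>V_k\<close> only. \<open>V_k'\<close> keeps the old value of \<open>V_k\<close>, because
  the stamp of the round to be undone is one more than its offset.\<close>

definition shrink_step :: com where
  "shrink_step = Basic (Copy V_k' V_k) \<Zsemi> Basic (Minus V_k V_k V_one) \<Zsemi>
     for_loop undo_change \<Zsemi> refine A_prefix A_suffix \<Zsemi> for_loop add_sizes \<Zsemi>
     for_loop load_key \<Zsemi> refine A_suffix A_key \<Zsemi> for_loop store_suffix"

definition shrink :: com where
  "shrink = While (Less V_zero V_k) shrink_step"

definition mappability :: com where
  "mappability = Basic (Assign V_one 1) \<Zsemi> Basic (Minus V_len V_n V_m) \<Zsemi>
     Basic (Plus V_len V_len V_one) \<Zsemi> grow \<Zsemi> for_loop load_size \<Zsemi> shrink"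

lemma changes_for_loop: "vars (for_loop c) = insert V_i (vars c)" "arrs (for_loop c) = arrs c"
  by (auto simp: for_loop_def)

lemma changes_steps:
  "vars load_key = {V_t}" "arrs load_key = {A_key}"
  "vars record_change = {V_r, V_t}" "arrs record_change = {A_time, A_parent, A_prefix}"
  "vars load_size = {V_r, V_t}" "arrs load_size = {A_equal}"
  "vars undo_change = {V_r, V_t}" "arrs undo_change = {A_prefix}"
  "vars add_sizes = {V_r, V_t, V_c}" "arrs add_sizes = {A_result}"
  "vars store_suffix = {V_t}" "arrs store_suffix = {A_suffix}"
  by (auto simp: load_key_def record_change_def load_size_def undo_change_def add_sizes_def
    store_suffix_def)

lemmas changes = changes_for_loop changes_steps changes_refine

lemma changes_grow_step:
  "vars grow_step = {V_i, V_x, V_r, V_t, V_c, V_b, V_p, V_k, V_k'}"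
  "arrs grow_step = {A_key, A_first, A_next, A_index, A_count, A_meet, A_time, A_parent, A_prefix}"
  unfolding grow_step_def by (auto simp: changes)

lemma changes_grow: "vars grow = vars grow_step" "arrs grow = arrs grow_step"
  unfolding grow_def by (auto simp: changes_grow_step)

lemma same_outsideD:
  assumes "same_outside c (v, a) (v', a')"
  shows "x \<notin> vars c \<Longrightarrow> v' x = v x" "A \<notin> arrs c \<Longrightarrow> a' A = a A"
  using assms by (auto simp: same_outside_def)

locale text_positions = positions n M N for n M N +
  fixes m :: nat and y :: "nat \<Rightarrow> nat"
  assumes m: "1 \<le> m" "N + m = n + 1"
    and y: "\<And>p. p < n \<Longrightarrow> y p < n"
begin

definition prepared :: "state \<Rightarrow> bool" where
  "prepared = (\<lambda>(v, a). v V_n = n \<and> v V_m = m \<and> v V_len = N \<and> v V_one = 1 \<and> v V_zero = 0 \<and>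
     (\<forall>p<n. a A_text p = Suc (y p)))"

lemma prepared_same:
  assumes "prepared (v, a)" "same_outside c (v, a) (v', a')"
    "vars c \<inter> {V_n, V_m, V_len, V_one, V_zero} = {}" "A_text \<notin> arrs c"
  shows "prepared (v', a')"
  using assms by (auto simp: prepared_def same_outside_def)

section \<open>Effects of the single passes over the positions\<close>

lemma triple_load_key:
  assumes s: "prepared (v0, a0)" and k: "v0 V_k < m"
  shows "triple (for_loop load_key) (16 * N) (v0, a0) (\<lambda>(v, a). \<forall>i<N. a A_key i = y (i + v0 V_k))"
proof -
  have "triple (for_loop load_key) (N * (cost load_key + 4) + 4) (v0, a0)
    (\<lambda>(v, a). \<forall>i<N. a A_key i = y (i + v0 V_k))"
  proof (rule triple_for_loop)
    fix i v a
    assume i: "i < N" "v V_i = i" and same: "\<And>x. x \<notin> vars load_key \<Longrightarrow> x \<noteq> V_i \<Longrightarrow> v x = v0 x"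
      "\<And>A. A \<notin> arrs load_key \<Longrightarrow> a A = a0 A" and I: "\<forall>j<i. a A_key j = y (j + v0 V_k)"
    have same': "v V_one = 1" "v V_k = v0 V_k" "a A_text = a0 A_text"
      using same s by (simp_all add: changes prepared_def)
    have p: "i + v0 V_k < n" using i k m by linarith
    then have "a0 A_text (i + v0 V_k) = Suc (y (i + v0 V_k))" "y (i + v0 V_k) < n"
      using s y by (auto simp: prepared_def)
    then show "wp load_key (\<lambda>(v', a'). \<forall>j<Suc i. a' A_key j = y (j + v0 V_k)) (v, a)"
      using i I p N unfolding load_key_def by (auto simp: same' less_Suc_eq)
  qed (use s in \<open>auto simp: changes prepared_def\<close>)
  then show ?thesis by (rule triple_weaken) (use N in \<open>auto simp: load_key_def\<close>)
qed

lemma triple_record_change: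
  assumes s: "prepared (v0, a0)"
  shows "triple (for_loop record_change) (20 * N) (v0, a0) (\<lambda>(v, a). \<forall>i<N.
     a A_prefix i = a0 A_meet i \<and>
     a A_time i = (if a0 A_prefix i = a0 A_meet i then a0 A_time i else v0 V_k') \<and>
     a A_parent i = (if a0 A_prefix i = a0 A_meet i then a0 A_parent i else a0 A_prefix i))"
proof -
  let ?P = "\<lambda>a i. a A_prefix i = a0 A_meet i \<and>
     a A_time i = (if a0 A_prefix i = a0 A_meet i then a0 A_time i else v0 V_k') \<and>
     a A_parent i = (if a0 A_prefix i = a0 A_meet i then a0 A_parent i else a0 A_prefix i)"
  \<comment> \<open>The pass updates its arrays in place, so the invariant also has to say that the
    entries from \<open>i\<close> on are still the old ones.\<close>
  let ?I = "\<lambda>i a. (\<forall>j<i. ?P a j) \<and> (\<forall>j\<ge>i. a A_prefix j = a0 A_prefix j \<and>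
     a A_time j = a0 A_time j \<and> a A_parent j = a0 A_parent j)"
  have "triple (for_loop record_change) (N * (cost record_change + 4) + 4) (v0, a0)
     (\<lambda>(v, a). ?I N a)"
  proof (rule triple_for_loop[where I = ?I])
    fix i v a
    assume i: "i < N" "v V_i = i"
      and same: "\<And>x. x \<notin> vars record_change \<Longrightarrow> x \<noteq> V_i \<Longrightarrow> v x = v0 x"
      "\<And>A. A \<notin> arrs record_change \<Longrightarrow> a A = a0 A" and I: "?I i a"
    have same': "v V_k' = v0 V_k'" "a A_meet = a0 A_meet"
      using same by (simp_all add: changes)
    have old: "\<And>j. j < i \<Longrightarrow> ?P a j" and new: "\<And>j. i \<le> j \<Longrightarrow> a A_prefix j = a0 A_prefix j"
      "\<And>j. i \<le> j \<Longrightarrow> a A_time j = a0 A_time j" "\<And>j. i \<le> j \<Longrightarrow> a A_parent j = a0 A_parent j"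
      using I by auto
    show "wp record_change (\<lambda>(v', a'). ?I (Suc i) a') (v, a)"
      using i N old unfolding record_change_def by (simp add: same' new less_Suc_eq)
  qed (use s in \<open>auto simp: changes prepared_def\<close>)
  then show ?thesis by (rule triple_weaken) (use N in \<open>auto simp: record_change_def\<close>)
qed

lemma triple_load_size:
  assumes s: "prepared (v0, a0)" and "\<And>i. i < N \<Longrightarrow> a0 A_prefix i < N"
  shows "triple (for_loop load_size) (14 * N) (v0, a0)
     (\<lambda>(v, a). \<forall>i<N. a A_equal i = a0 A_count (a0 A_prefix i))"
proof -
  have "triple (for_loop load_size) (N * (cost load_size + 4) + 4) (v0, a0)
     (\<lambda>(v, a). \<forall>i<N. a A_equal i = a0 A_count (a0 A_prefix i))"
  proof (rule triple_for_loop)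
    fix i v a
    assume i: "i < N" "v V_i = i"
      and same: "\<And>x. x \<notin> vars load_size \<Longrightarrow> x \<noteq> V_i \<Longrightarrow> v x = v0 x"
      "\<And>A. A \<notin> arrs load_size \<Longrightarrow> a A = a0 A"
      and I: "\<forall>j<i. a A_equal j = a0 A_count (a0 A_prefix j)"
    have same': "a A_prefix = a0 A_prefix" "a A_count = a0 A_count"
      using same by (simp_all add: changes)
    have "a0 A_prefix i < n" using assms(2)[OF i(1)] N by simp
    then show "wp load_size (\<lambda>(v', a'). \<forall>j<Suc i. a' A_equal j = a0 A_count (a0 A_prefix j)) (v, a)"
      using i N I unfolding load_size_def by (simp add: same' less_Suc_eq)
  qed (use s in \<open>auto simp: changes prepared_def\<close>)
  then show ?thesis by (rule triple_weaken) (use N in \<open>auto simp: load_size_def\<close>)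
qed

lemma triple_undo_change:
  assumes s: "prepared (v0, a0)" and "\<And>i. i < N \<Longrightarrow> a0 A_prefix i < N"
  shows "triple (for_loop undo_change) (18 * N) (v0, a0) (\<lambda>(v, a). \<forall>i<N. a A_prefix i =
     (if a0 A_time (a0 A_prefix i) = v0 V_k' then a0 A_parent (a0 A_prefix i) else a0 A_prefix i))"
proof -
  let ?h = "\<lambda>i. if a0 A_time (a0 A_prefix i) = v0 V_k' then a0 A_parent (a0 A_prefix i)
    else a0 A_prefix i"
  let ?I = "\<lambda>i a. (\<forall>j<i. a A_prefix j = ?h j) \<and> (\<forall>j\<ge>i. a A_prefix j = a0 A_prefix j)"
  have "triple (for_loop undo_change) (N * (cost undo_change + 4) + 4) (v0, a0) (\<lambda>(v, a). ?I N a)"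
  proof (rule triple_for_loop[where I = ?I])
    fix i v a
    assume i: "i < N" "v V_i = i"
      and same: "\<And>x. x \<notin> vars undo_change \<Longrightarrow> x \<noteq> V_i \<Longrightarrow> v x = v0 x"
      "\<And>A. A \<notin> arrs undo_change \<Longrightarrow> a A = a0 A" and I: "?I i a"
    have same': "v V_k' = v0 V_k'" "a A_time = a0 A_time" "a A_parent = a0 A_parent"
      using same by (simp_all add: changes)
    have old: "\<And>j. j < i \<Longrightarrow> a A_prefix j = ?h j"
      and new: "\<And>j. i \<le> j \<Longrightarrow> a A_prefix j = a0 A_prefix j"
      using I by auto
    have "a0 A_prefix i < n" using assms(2)[OF i(1)] N by simp
    then show "wp undo_change (\<lambda>(v', a'). ?I (Suc i) a') (v, a)"
      using i N old unfolding undo_change_def by (simp add: same' new less_Suc_eq)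
  qed (use s in \<open>auto simp: changes prepared_def\<close>)
  then show ?thesis by (rule triple_weaken) (use N in \<open>auto simp: undo_change_def\<close>)
qed

lemma triple_add_sizes:
  assumes s: "prepared (v0, a0)" and "\<And>i. i < N \<Longrightarrow> a0 A_meet i < N"
    and bounds: "\<And>i. i < N \<Longrightarrow> a0 A_equal i \<le> a0 A_count (a0 A_meet i)"
      "\<And>i. i < N \<Longrightarrow> a0 A_count (a0 A_meet i) \<le> N"
      "\<And>i. i < N \<Longrightarrow> a0 A_result i + (a0 A_count (a0 A_meet i) - a0 A_equal i) \<le> N"
  shows "triple (for_loop add_sizes) (22 * N) (v0, a0) (\<lambda>(v, a). \<forall>i<N. a A_result i =
     a0 A_result i + (a0 A_count (a0 A_meet i) - a0 A_equal i))"
proof -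
  let ?h = "\<lambda>i. a0 A_result i + (a0 A_count (a0 A_meet i) - a0 A_equal i)"
  let ?I = "\<lambda>i a. (\<forall>j<i. a A_result j = ?h j) \<and> (\<forall>j\<ge>i. a A_result j = a0 A_result j)"
  have "triple (for_loop add_sizes) (N * (cost add_sizes + 4) + 4) (v0, a0) (\<lambda>(v, a). ?I N a)"
  proof (rule triple_for_loop[where I = ?I])
    fix i v a
    assume i: "i < N" "v V_i = i"
      and same: "\<And>x. x \<notin> vars add_sizes \<Longrightarrow> x \<noteq> V_i \<Longrightarrow> v x = v0 x"
      "\<And>A. A \<notin> arrs add_sizes \<Longrightarrow> a A = a0 A" and I: "?I i a"
    have same': "a A_meet = a0 A_meet" "a A_count = a0 A_count" "a A_equal = a0 A_equal"
      using same by (simp_all add: changes)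
    have old: "\<And>j. j < i \<Longrightarrow> a A_result j = ?h j"
      and new: "\<And>j. i \<le> j \<Longrightarrow> a A_result j = a0 A_result j"
      using I by auto
    have "a0 A_meet i < n" "a0 A_count (a0 A_meet i) < M" "?h i < M" "i < n"
      using assms(2)[OF i(1)] bounds(2,3)[OF i(1)] i N by linarith+
    then show "wp add_sizes (\<lambda>(v', a'). ?I (Suc i) a') (v, a)"
      using i old new bounds(1) unfolding add_sizes_def by (simp add: same' less_Suc_eq)
  qed (use s in \<open>auto simp: changes prepared_def\<close>)
  then show ?thesis by (rule triple_weaken) (use N in \<open>auto simp: add_sizes_def\<close>)
qed

lemma triple_store_suffix:
  assumes s: "prepared (v0, a0)"
  shows "triple (for_loop store_suffix) (12 * N) (v0, a0) (\<lambda>(v, a). \<forall>i<N. a A_suffix i = a0 A_meet i)"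
proof -
  have "triple (for_loop store_suffix) (N * (cost store_suffix + 4) + 4) (v0, a0)
     (\<lambda>(v, a). \<forall>i<N. a A_suffix i = a0 A_meet i)"
  proof (rule triple_for_loop)
    fix i v a
    assume i: "i < N" "v V_i = i"
      and same: "\<And>x. x \<notin> vars store_suffix \<Longrightarrow> x \<noteq> V_i \<Longrightarrow> v x = v0 x"
      "\<And>A. A \<notin> arrs store_suffix \<Longrightarrow> a A = a0 A"
      and I: "\<forall>j<i. a A_suffix j = a0 A_meet j"
    have "a A_meet = a0 A_meet" using same by (simp add: changes)
    then show "wp store_suffix (\<lambda>(v', a'). \<forall>j<Suc i. a' A_suffix j = a0 A_meet j) (v, a)"
      using i N I unfolding store_suffix_def by (simp add: less_Suc_eq)
  qed (use s in \<open>auto simp: changes prepared_def\<close>)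
  then show ?thesis by (rule triple_weaken) (use N in \<open>auto simp: store_suffix_def\<close>)
qed

text \<open>Refinement yields the counters only at representatives; every other position obtains its
  class size through its representative, by \<open>class_size_cong\<close>.\<close>

lemma triple_refine_rep:
  assumes s: "prepared (v0, a0)" and "\<And>i. i < N \<Longrightarrow> a0 F i = rep y S i" "F < 13"
      "F \<notin> {A_first, A_next, A_index, A_count, A_meet}"
    and g: "\<And>i. i < N \<Longrightarrow> a0 G i = g i" "\<And>i. i < N \<Longrightarrow> g i < n" "G < 13"
      "G \<notin> {A_first, A_next, A_index, A_count, A_meet}"
    and meet: "\<And>i. meet (rep y S) g i = rep y T i"
  shows "triple (refine F G) (138 * N) (v0, a0) (\<lambda>(v, a). \<forall>i<N. a A_meet i = rep y T i \<and>
    a A_count (rep y T i) = class_size N y T i)"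
proof -
  have "triple (refine F G) (138 * N) (v0, a0) (\<lambda>(v, a). \<forall>i<N. a A_meet i = meet (rep y S) g i \<and>
    (meet (rep y S) g i = i \<longrightarrow>
      a A_count i = card {j. j < N \<and> rep y S j = rep y S i \<and> g j = g i}))"
    using s assms(2-8) canonical_rep by (intro triple_refine) (auto simp: prepared_def)
  then show ?thesis
  proof (rule triple_weaken)
    fix v a
    assume "case (v, a) of (v, a) \<Rightarrow> \<forall>i<N. a A_meet i = meet (rep y S) g i \<and>
      (meet (rep y S) g i = i \<longrightarrow>
        a A_count i = card {j. j < N \<and> rep y S j = rep y S i \<and> g j = g i})"
    then have 1: "\<And>i. i < N \<Longrightarrow> a A_meet i = rep y T i"
      and 2: "\<And>i. i < N \<Longrightarrow> rep y T i = i \<Longrightarrow>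
        a A_count i = card {j. j < N \<and> rep y S j = rep y S i \<and> g j = g i}"
      by (auto simp: meet)
    \<comment> \<open>The meet determines both keys and is determined by them, so
      \<open>meet\<close> alone already identifies the classes with those of
      \<open>agree y T\<close>.\<close>
    have both: "rep y S j = rep y S i \<and> g j = g i \<longleftrightarrow> agree y T j i" for i j
    proof
      assume "rep y S j = rep y S i \<and> g j = g i"
      then show "agree y T j i" using meet_cong[of "rep y S" j i g] by (simp add: meet rep_eq_iff)
    next
      assume "agree y T j i"
      then have "meet (rep y S) g j = meet (rep y S) g i" by (simp add: meet rep_eq_iff)
      then show "rep y S j = rep y S i \<and> g j = g i"
        using meet_same[of "rep y S" g i] meet_same[of "rep y S" g j] by metis
    qed
    have "a A_count (rep y T i) = class_size N y T i" if "i < N" for i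
    proof -
      have "rep y T i < N" using rep_le[of y T i] that by simp
      then have "a A_count (rep y T i) = class_size N y T (rep y T i)"
        using 2 rep_rep both by simp
      then show ?thesis using class_size_cong agree_rep by metis
    qed
    then show "case (v, a) of (v, a) \<Rightarrow> \<forall>i<N. a A_meet i = rep y T i \<and>
        a A_count (rep y T i) = class_size N y T i"
      using 1 by simp
  qed simp
qed

text \<open>No class has been counted before the first round, hence the guard on the last clause;
  \<open>1 \<le> m\<close> discharges it when the phase ends.\<close>

definition grow_inv :: "state \<Rightarrow> bool" where
  "grow_inv = (\<lambda>(v, a). prepared (v, a) \<and> v V_k \<le> m \<and> (\<forall>i<N. a A_prefix i = rep y {..<v V_k} i) \<and>
     recorded N y (v V_k) (a A_time) (a A_parent) \<and>
     (0 < v V_k \<longrightarrow> (\<forall>i<N. a A_count (rep y {..<v V_k} i) = class_size N y {..<v V_k} i)))"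

lemma triple_grow_step:
  assumes I: "grow_inv (v0, a0)" and k: "v0 V_k < m"
  shows "triple grow_step (178 * N) (v0, a0)
    (\<lambda>(v, a). grow_inv (v, a) \<and> v V_k = Suc (v0 V_k))"
proof -
  define k where "k = v0 V_k"
  let ?Q = "\<lambda>(v, a). grow_inv (v, a) \<and> v V_k = Suc (v0 V_k)"
  have I': "prepared (v0, a0)" "\<And>i. i < N \<Longrightarrow> a0 A_prefix i = rep y {..<k} i"
    "recorded N y k (a0 A_time) (a0 A_parent)"
    using I by (auto simp: grow_inv_def k_def)
  have "triple grow_step (16 * N + (138 * N + (2 + (20 * N + 2)))) (v0, a0) ?Q"
    unfolding grow_step_def
  proof (rule triple_Seq[OF triple_load_key[OF I'(1) k]])
    fix v1 a1
    assume same: "same_outside (for_loop load_key) (v0, a0) (v1, a1)"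
      and key: "case (v1, a1) of (v, a) \<Rightarrow> \<forall>i<N. a A_key i = y (i + v0 V_k)"
    note s1 = same_outsideD[OF same, unfolded changes]
    have prepared1: "prepared (v1, a1)" using I'(1) same by (rule prepared_same) (auto simp: changes)
    have bound: "y (i + k) < n" if "i < N" for i
      using that k m by (intro y) (simp add: k_def)
    have refine: "triple (refine A_prefix A_key) (138 * N) (v1, a1)
       (\<lambda>(v, a). \<forall>i<N. a A_meet i = rep y {..<Suc k} i \<and>
         a A_count (rep y {..<Suc k} i) = class_size N y {..<Suc k} i)"
      using prepared1 I'(2) s1 key bound
      by (intro triple_refine_rep[where S = "{..<k}" and g = "\<lambda>i. y (i + k)"])
        (auto simp: k_def meet_rep_letter lessThan_Suc)
    show "triple (refine A_prefix A_key \<Zsemi> Basic (Plus V_k' V_k V_one) \<Zsemi> for_loop record_change \<Zsemi>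
      Basic (Copy V_k V_k')) (138 * N + (2 + (20 * N + 2))) (v1, a1) ?Q"
    proof (rule triple_Seq[OF refine])
      fix v2 a2
      assume same: "same_outside (refine A_prefix A_key) (v1, a1) (v2, a2)"
        and meet: "case (v2, a2) of (v, a) \<Rightarrow> \<forall>i<N. a A_meet i = rep y {..<Suc k} i \<and>
          a A_count (rep y {..<Suc k} i) = class_size N y {..<Suc k} i"
      note s2 = same_outsideD[OF same, unfolded changes]
      have prepared2: "prepared (v2, a2)" using prepared1 same by (rule prepared_same) (auto simp: changes)
      let ?v = "v2(V_k' := Suc k)"
      have prepared3: "prepared (?v, a2)" using prepared2 by (simp add: prepared_def)
      have "triple (Basic (Plus V_k' V_k V_one)) 2 (v2, a2) (\<lambda>s. s = (?v, a2))"
        using triple_wp[of "Basic (Plus V_k' V_k V_one)" "\<lambda>s. s = (?v, a2)" "(v2, a2)"]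
          prepared2 s1 s2 k m N
        by (simp add: prepared_def k_def)
      then show "triple (Basic (Plus V_k' V_k V_one) \<Zsemi> for_loop record_change \<Zsemi>
        Basic (Copy V_k V_k')) (2 + (20 * N + 2)) (v2, a2) ?Q"
      proof (rule triple_Seq)
        fix v a
        assume "(v, a) = (?v, a2)"
        show "triple (for_loop record_change \<Zsemi> Basic (Copy V_k V_k')) (20 * N + 2) (v, a) ?Q"
          unfolding \<open>(v, a) = (?v, a2)\<close>
        proof (rule triple_Seq[OF triple_record_change[OF prepared3]])
          fix v3 a3
          assume same: "same_outside (for_loop record_change) (?v, a2) (v3, a3)"
            and changed: "case (v3, a3) of (v, a) \<Rightarrow> \<forall>i<N. a A_prefix i = a2 A_meet i \<and>
               a A_time i = (if a2 A_prefix i = a2 A_meet i then a2 A_time i else ?v V_k') \<and>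
               a A_parent i = (if a2 A_prefix i = a2 A_meet i then a2 A_parent i else a2 A_prefix i)"
          note s3 = same_outsideD[OF same, unfolded changes]
          have "prepared (v3, a3)" using prepared3 same by (rule prepared_same) (auto simp: changes)
          then have "prepared (v3(V_k := Suc k), a3)" by (simp add: prepared_def)
          moreover have "recorded N y (Suc k) (a3 A_time) (a3 A_parent)"
            using I'(3) by (rule recorded_Suc) (use changed meet s1 s2 I'(2) in simp_all)
          moreover have "\<forall>i<N. a3 A_prefix i = rep y {..<Suc k} i" using changed meet by simp
          moreover have "\<forall>i<N. a3 A_count (rep y {..<Suc k} i) = class_size N y {..<Suc k} i"
            using meet s3 by simp
          ultimately have "grow_inv (v3(V_k := Suc k), a3)"
            using k by (simp add: grow_inv_def k_def)
          then show "triple (Basic (Copy V_k V_k')) 2 (v3, a3) ?Q"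
            using triple_wp[of "Basic (Copy V_k V_k')" ?Q "(v3, a3)"] s3 by (simp add: k_def)
        qed
      qed
    qed
  qed
  then show ?thesis by (rule triple_weaken) (use N in auto)
qed

lemma triple_grow:
  assumes s: "prepared (v0, a0)" and zero: "\<And>i. i < N \<Longrightarrow> a0 A_prefix i = 0" "\<And>i. i < N \<Longrightarrow> a0 A_time i = 0"
  shows "triple grow (2 + (m * (178 * N + 2) + 2)) (v0, a0) (\<lambda>(v, a). grow_inv (v, a) \<and> v V_k = m)"
proof -
  let ?s = "(v0(V_k := 0), a0)"
  \<comment> \<open>Zeroed memory is already a valid start: the partition by no letters has the
    single representative \<open>0\<close>, and no change has been stamped yet.\<close>
  have start: "grow_inv ?s" using s zero by (simp add: grow_inv_def prepared_def recorded_def)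
  have "triple (While (Less V_k V_m) grow_step) (m * (178 * N + 2) + 2) ?s
    (\<lambda>(v, a). grow_inv (v, a) \<and> v V_k = m)"
  proof (rule triple_While[where I = grow_inv and f = "\<lambda>(v, a). m - v V_k"])
    fix v a
    assume I: "grow_inv (v, a)" and "holds (Less V_k V_m) (v, a)"
    then have k: "v V_k < m" by (simp add: grow_inv_def prepared_def)
    show "triple grow_step (178 * N) (v, a) (\<lambda>s'. grow_inv s' \<and>
        (case s' of (v, a) \<Rightarrow> m - v V_k) < (case (v, a) of (v, a) \<Rightarrow> m - v V_k))"
      using triple_grow_step[OF I k] by (rule triple_weaken) (use k in auto)
  next
    fix v a
    assume "grow_inv (v, a)" and "\<not> holds (Less V_k V_m) (v, a)"
    then show "case (v, a) of (v, a) \<Rightarrow> grow_inv (v, a) \<and> v V_k = m"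
      by (auto simp: grow_inv_def prepared_def)
  qed (use start in auto)
  moreover have "triple (Basic (Assign V_k 0)) 2 (v0, a0) (\<lambda>s. s = ?s)"
    using triple_wp[of "Basic (Assign V_k 0)" "\<lambda>s. s = ?s" "(v0, a0)"] N by simp
  ultimately show ?thesis unfolding grow_def by (intro triple_Seq[where Q = "\<lambda>s. s = ?s"]) auto
qed

text \<open>The history stays at level \<open>m\<close> while \<open>V_k\<close> decreases: undoing
  only reads it, and what it says about small levels remains valid.\<close>

definition shrink_inv :: "state \<Rightarrow> bool" where
  "shrink_inv = (\<lambda>(v, a). prepared (v, a) \<and> v V_k \<le> m \<and> (\<forall>i<N. a A_prefix i = rep y {..<v V_k} i) \<and>
     recorded N y m (a A_time) (a A_parent) \<and>
     (\<forall>i<N. a A_suffix i = rep y {v V_k..<m} i) \<and>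
     (\<forall>i<N. a A_equal i = class_size N y {..<m} i) \<and>
     (\<forall>i<N. a A_result i = card (near N y m (v V_k) i)))"

lemma rep_less: "i < N \<Longrightarrow> rep y T i < N"
  using rep_le[of y T i] by simp

lemma triple_shrink_step:
  assumes I: "shrink_inv (v0, a0)" and k: "0 < v0 V_k"
  shows "triple shrink_step (348 * N) (v0, a0)
    (\<lambda>(v, a). shrink_inv (v, a) \<and> Suc (v V_k) = v0 V_k)"
proof -
  obtain k where k: "v0 V_k = Suc k" using k by (cases "v0 V_k") auto
  let ?Q = "\<lambda>(v, a). shrink_inv (v, a) \<and> Suc (v V_k) = v0 V_k"
  let ?T = "{..<k} \<union> {Suc k..<m}"
  have I': "prepared (v0, a0)" "k < m" "\<And>i. i < N \<Longrightarrow> a0 A_prefix i = rep y {..<Suc k} i"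
    "recorded N y m (a0 A_time) (a0 A_parent)" "\<And>i. i < N \<Longrightarrow> a0 A_suffix i = rep y {Suc k..<m} i"
    "\<And>i. i < N \<Longrightarrow> a0 A_equal i = class_size N y {..<m} i"
    "\<And>i. i < N \<Longrightarrow> a0 A_result i = card (near N y m (Suc k) i)"
    using I by (auto simp: shrink_inv_def k)
  let ?v = "v0(V_k' := Suc k, V_k := k)"
  have prepared1: "prepared (?v, a0)" using I'(1) by (simp add: prepared_def)
  define rest where "rest = refine A_prefix A_suffix \<Zsemi> for_loop add_sizes \<Zsemi>
     for_loop load_key \<Zsemi> refine A_suffix A_key \<Zsemi> for_loop store_suffix"
  have rest: "triple rest (138 * N + (22 * N + (16 * N + (138 * N + 12 * N)))) (v1, a1) ?Q"
    if same: "same_outside (for_loop undo_change) (?v, a0) (v1, a1)"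
      and undone: "\<And>i. i < N \<Longrightarrow> a1 A_prefix i = rep y {..<k} i" for v1 a1
  proof -
    note s1 = same_outsideD[OF same, unfolded changes]
    have prepared1: "prepared (v1, a1)" using prepared1 same by (rule prepared_same) (auto simp: changes)
    have less: "rep y {Suc k..<m} i < n" if "i < N" for i
      using rep_less[OF that, of "{Suc k..<m}"] N by simp
    have refine: "triple (refine A_prefix A_suffix) (138 * N) (v1, a1)
       (\<lambda>(v, a). \<forall>i<N. a A_meet i = rep y ?T i \<and> a A_count (rep y ?T i) = class_size N y ?T i)"
      using prepared1 undone s1 I'(5) less
      by (intro triple_refine_rep[where S = "{..<k}" and g = "rep y {Suc k..<m}"])
        (auto simp: meet_rep)
    show ?thesis
      unfolding rest_def
    proof (rule triple_Seq[OF refine])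
      fix v2 a2
      assume same: "same_outside (refine A_prefix A_suffix) (v1, a1) (v2, a2)"
        and meet: "case (v2, a2) of (v, a) \<Rightarrow> \<forall>i<N. a A_meet i = rep y ?T i \<and>
          a A_count (rep y ?T i) = class_size N y ?T i"
      note s2 = same_outsideD[OF same, unfolded changes]
      have prepared2: "prepared (v2, a2)" using prepared1 same by (rule prepared_same) (auto simp: changes)
      have meet2: "a2 A_meet i = rep y ?T i" "a2 A_count (rep y ?T i) = class_size N y ?T i"
        if "i < N" for i
        using meet that by simp_all
      have result2: "a2 A_equal i = class_size N y {..<m} i"
        "a2 A_result i = card (near N y m (Suc k) i)" if "i < N" for i
        using I'(6,7) that s1 s2 by simp_all
      have sum: "a2 A_result i + (a2 A_count (a2 A_meet i) - a2 A_equal i) = card (near N y m k i)"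
        if "i < N" for i
        using near_Suc[OF I'(2)] meet2 result2 that by simp
      \<comment> \<open>This inequality is the safety condition of the subtraction in
        \<open>add_sizes\<close>.\<close>
      have "class_size N y {..<m} i \<le> class_size N y ?T i" for i
        by (rule class_size_mono) (use I'(2) in auto)
      then have add: "triple (for_loop add_sizes) (22 * N) (v2, a2) (\<lambda>(v, a). \<forall>i<N. a A_result i =
          a2 A_result i + (a2 A_count (a2 A_meet i) - a2 A_equal i))"
        using prepared2 meet2 result2 rep_less sum card_near_le class_size_le
        by (intro triple_add_sizes) simp_all
      show "triple (for_loop add_sizes \<Zsemi> for_loop load_key \<Zsemi> refine A_suffix A_key \<Zsemi>
          for_loop store_suffix) (22 * N + (16 * N + (138 * N + 12 * N))) (v2, a2) ?Q"
      proof (rule triple_Seq[OF add])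
        fix v3 a3
        assume same: "same_outside (for_loop add_sizes) (v2, a2) (v3, a3)"
          and added: "case (v3, a3) of (v, a) \<Rightarrow> \<forall>i<N. a A_result i =
            a2 A_result i + (a2 A_count (a2 A_meet i) - a2 A_equal i)"
        note s3 = same_outsideD[OF same, unfolded changes]
        have prepared3: "prepared (v3, a3)" using prepared2 same by (rule prepared_same) (auto simp: changes)
        have k3: "v3 V_k = k" using s1 s2 s3 by simp
        have "v3 V_k < m" using k3 I'(2) by simp
        then show "triple (for_loop load_key \<Zsemi> refine A_suffix A_key \<Zsemi> for_loop store_suffix)
          (16 * N + (138 * N + 12 * N)) (v3, a3) ?Q"
        proof (rule triple_Seq[OF triple_load_key[OF prepared3]])
          fix v4 a4
          assume same: "same_outside (for_loop load_key) (v3, a3) (v4, a4)"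
            and key: "case (v4, a4) of (v, a) \<Rightarrow> \<forall>i<N. a A_key i = y (i + v3 V_k)"
          note s4 = same_outsideD[OF same, unfolded changes]
          have prepared4: "prepared (v4, a4)" using prepared3 same by (rule prepared_same) (auto simp: changes)
          have bound: "y (i + k) < n" if "i < N" for i
            using that I'(2) m by (intro y) simp
          have "{Suc k..<m} \<union> {k} = {k..<m}" using I'(2) by auto
          then have refine: "triple (refine A_suffix A_key) (138 * N) (v4, a4)
             (\<lambda>(v, a). \<forall>i<N. a A_meet i = rep y {k..<m} i \<and>
               a A_count (rep y {k..<m} i) = class_size N y {k..<m} i)"
            using prepared4 I'(5) s1 s2 s3 s4 key k3 bound
              meet_rep_letter[of y "{Suc k..<m}" k]
            by (intro triple_refine_rep[where S = "{Suc k..<m}" and g = "\<lambda>i. y (i + k)"]) simp_all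
          show "triple (refine A_suffix A_key \<Zsemi> for_loop store_suffix) (138 * N + 12 * N) (v4, a4) ?Q"
          proof (rule triple_Seq[OF refine])
            fix v5 a5
            assume same: "same_outside (refine A_suffix A_key) (v4, a4) (v5, a5)"
              and meet': "case (v5, a5) of (v, a) \<Rightarrow> \<forall>i<N. a A_meet i = rep y {k..<m} i \<and>
                a A_count (rep y {k..<m} i) = class_size N y {k..<m} i"
            note s5 = same_outsideD[OF same, unfolded changes]
            have prepared5: "prepared (v5, a5)" using prepared4 same by (rule prepared_same) (auto simp: changes)
            show "triple (for_loop store_suffix) (12 * N) (v5, a5) ?Q"
              using triple_store_suffix[OF prepared5]
            proof (rule triple_weaken)
              fix v6 a6
              assume same: "same_outside (for_loop store_suffix) (v5, a5) (v6, a6)"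
                and stored: "case (v6, a6) of (v, a) \<Rightarrow> \<forall>i<N. a A_suffix i = a5 A_meet i"
              note s6 = same_outsideD[OF same, unfolded changes]
              have "prepared (v6, a6)" using prepared5 same by (rule prepared_same) (auto simp: changes)
              moreover have "v6 V_k = k" using k3 s4 s5 s6 by simp
              moreover have "\<forall>i<N. a6 A_prefix i = rep y {..<k} i"
                using undone s2 s3 s4 s5 s6 by simp
              moreover have "recorded N y m (a6 A_time) (a6 A_parent)"
                using I'(4) s1 s2 s3 s4 s5 s6 by simp
              moreover have "\<forall>i<N. a6 A_suffix i = rep y {k..<m} i"
                using stored meet' by simp
              moreover have "\<forall>i<N. a6 A_equal i = class_size N y {..<m} i"
                using I'(6) s1 s2 s3 s4 s5 s6 by simp
              moreover have "\<forall>i<N. a6 A_result i = card (near N y m k i)"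
                using added sum s4 s5 s6 by simp
              ultimately show "?Q (v6, a6)" using I'(2) k by (simp add: shrink_inv_def)
            qed simp
          qed
        qed
      qed
    qed
  qed
  have undo: "triple (for_loop undo_change) (18 * N) (?v, a0)
     (\<lambda>(v, a). \<forall>i<N. a A_prefix i = rep y {..<k} i)"
  proof (rule triple_weaken[OF triple_undo_change[OF prepared1]])
    show "\<And>i. i < N \<Longrightarrow> a0 A_prefix i < N" using I'(3) rep_less by simp
  next
    fix v a
    assume "case (v, a) of (v, a) \<Rightarrow> \<forall>i<N. a A_prefix i =
      (if a0 A_time (a0 A_prefix i) = ?v V_k' then a0 A_parent (a0 A_prefix i) else a0 A_prefix i)"
    then show "case (v, a) of (v, a) \<Rightarrow> \<forall>i<N. a A_prefix i = rep y {..<k} i"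
      using recorded_back[OF I'(4,2)] I'(3) by simp
  qed simp
  have t3: "triple (for_loop undo_change \<Zsemi> rest)
      (18 * N + (138 * N + (22 * N + (16 * N + (138 * N + 12 * N))))) (?v, a0) ?Q"
    using undo by (rule triple_Seq) (rule rest; simp)
  have t2: "triple (Basic (Minus V_k V_k V_one)) 2 (v0(V_k' := Suc k), a0) (\<lambda>s. s = (?v, a0))"
    using triple_wp[of "Basic (Minus V_k V_k V_one)" "\<lambda>s. s = (?v, a0)" "(v0(V_k' := Suc k), a0)"]
      I'(1,2) k m N
    by (simp add: prepared_def)
  have t1: "triple (Basic (Copy V_k' V_k)) 2 (v0, a0) (\<lambda>s. s = (v0(V_k' := Suc k), a0))"
    using triple_wp[of "Basic (Copy V_k' V_k)" "\<lambda>s. s = (v0(V_k' := Suc k), a0)" "(v0, a0)"] k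
    by simp
  have "triple shrink_step
      (2 + (2 + (18 * N + (138 * N + (22 * N + (16 * N + (138 * N + 12 * N))))))) (v0, a0) ?Q"
    unfolding shrink_step_def rest_def[symmetric]
    by (rule triple_Seq_eq[OF t1 triple_Seq_eq[OF t2 t3]])
  then show ?thesis by (rule triple_weaken) (use N in auto)
qed

lemma triple_shrink:
  assumes "shrink_inv (v0, a0)"
  shows "triple shrink (m * (348 * N + 2) + 2) (v0, a0)
    (\<lambda>(v, a). \<forall>i<N. a A_result i = card (near N y m 0 i))"
  unfolding shrink_def
proof (rule triple_While[where I = shrink_inv and f = "\<lambda>(v, a). v V_k"])
  fix v a
  assume I: "shrink_inv (v, a)" and "holds (Less V_zero V_k) (v, a)"
  then have k: "0 < v V_k" by (simp add: shrink_inv_def prepared_def)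
  show "triple shrink_step (348 * N) (v, a) (\<lambda>s'. shrink_inv s' \<and>
      (case s' of (v, a) \<Rightarrow> v V_k) < (case (v, a) of (v, a) \<Rightarrow> v V_k))"
    using triple_shrink_step[OF I k] by (rule triple_weaken) auto
next
  fix v a
  assume "shrink_inv (v, a)" and "\<not> holds (Less V_zero V_k) (v, a)"
  then show "case (v, a) of (v, a) \<Rightarrow> \<forall>i<N. a A_result i = card (near N y m 0 i)"
    by (simp add: shrink_inv_def prepared_def)
qed (use assms in \<open>auto simp: shrink_inv_def\<close>)

lemma triple_mappability:
  assumes v0: "v0 = (\<lambda>_. 0)(V_n := n, V_m := m)"
    and a0: "\<And>p. p < n \<Longrightarrow> a0 A_text p = Suc (y p)" "\<And>A i. 0 < A \<Longrightarrow> A < 13 \<Longrightarrow> i < n \<Longrightarrow> a0 A i = 0"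
  shows "triple mappability (600 * (m * n)) (v0, a0)
    (\<lambda>(v, a). \<forall>i<N. a A_result i = card (near N y m 0 i))"
    (is "triple _ _ _ ?Q")
proof -
  let ?v = "v0(V_one := 1, V_len := N)"
  have prepared: "prepared (?v, a0)" using a0 by (simp add: prepared_def v0)
  have zero: "\<And>A i. 0 < A \<Longrightarrow> A < 13 \<Longrightarrow> i < N \<Longrightarrow> a0 A i = 0" using a0(2) N by simp
  have t4: "triple (grow \<Zsemi> for_loop load_size \<Zsemi> shrink)
      ((2 + (m * (178 * N + 2) + 2)) + (14 * N + (m * (348 * N + 2) + 2))) (?v, a0) ?Q"
  proof (rule triple_Seq[OF triple_grow[OF prepared]])
    show "\<And>i. i < N \<Longrightarrow> a0 A_prefix i = 0" "\<And>i. i < N \<Longrightarrow> a0 A_time i = 0"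
      by (rule zero; simp)+
  next
    fix v1 a1
    assume same: "same_outside grow (?v, a0) (v1, a1)"
      and "case (v1, a1) of (v, a) \<Rightarrow> grow_inv (v, a) \<and> v V_k = m"
    then have I: "prepared (v1, a1)" "v1 V_k = m" "\<And>i. i < N \<Longrightarrow> a1 A_prefix i = rep y {..<m} i"
      "recorded N y m (a1 A_time) (a1 A_parent)"
      "\<And>i. i < N \<Longrightarrow> a1 A_count (rep y {..<m} i) = class_size N y {..<m} i"
      using m by (auto simp: grow_inv_def)
    note s1 = same_outsideD[OF same, unfolded changes_grow changes_grow_step]
    have prefix: "\<And>i. i < N \<Longrightarrow> a1 A_prefix i < N" using I(3) rep_less by simp
    show "triple (for_loop load_size \<Zsemi> shrink) (14 * N + (m * (348 * N + 2) + 2)) (v1, a1) ?Q"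
    proof (rule triple_Seq[OF triple_load_size[OF I(1) prefix]])
      fix v2 a2
      assume same: "same_outside (for_loop load_size) (v1, a1) (v2, a2)"
        and equal: "case (v2, a2) of (v, a) \<Rightarrow> \<forall>i<N. a A_equal i = a1 A_count (a1 A_prefix i)"
      note s2 = same_outsideD[OF same, unfolded changes]
      have "prepared (v2, a2)" using I(1) same by (rule prepared_same) (auto simp: changes)
      moreover have "v2 V_k = m" using I(2) s2 by simp
      \<comment> \<open>Again zeroed memory is right: \<open>{m..<m}\<close> is empty, so
        \<open>0\<close> represents every position, and no offset has contributed to the
        result.\<close>
      moreover have "\<forall>i<N. a2 A_suffix i = 0" "\<forall>i<N. a2 A_result i = 0"
        using s1 s2 zero by simp_all
      ultimately have "shrink_inv (v2, a2)"
        using I s2 equal by (simp add: shrink_inv_def near_end)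
      then show "triple shrink (m * (348 * N + 2) + 2) (v2, a2) ?Q" by (rule triple_shrink)
    qed
  qed
  have t1: "triple (Basic (Assign V_one 1)) 2 (v0, a0) (\<lambda>s. s = (v0(V_one := 1), a0))"
    using triple_wp[of "Basic (Assign V_one 1)" "\<lambda>s. s = (v0(V_one := 1), a0)" "(v0, a0)"] N by simp
  have t2: "triple (Basic (Minus V_len V_n V_m)) 2 (v0(V_one := 1), a0)
      (\<lambda>s. s = (v0(V_one := 1, V_len := n - m), a0))"
    using triple_wp[of "Basic (Minus V_len V_n V_m)"
      "\<lambda>s. s = (v0(V_one := 1, V_len := n - m), a0)" "(v0(V_one := 1), a0)"] N m
    by (simp add: v0)
  have "n - m + 1 = N" using m N by simp
  then have t3: "triple (Basic (Plus V_len V_len V_one)) 2 (v0(V_one := 1, V_len := n - m), a0)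
      (\<lambda>s. s = (?v, a0))"
    using triple_wp[of "Basic (Plus V_len V_len V_one)"
      "\<lambda>s. s = (?v, a0)" "(v0(V_one := 1, V_len := n - m), a0)"] N
    by (simp add: v0)
  have "triple mappability (2 + (2 + (2 + ((2 + (m * (178 * N + 2) + 2)) +
      (14 * N + (m * (348 * N + 2) + 2)))))) (v0, a0) ?Q"
    unfolding mappability_def
    by (rule triple_Seq_eq[OF t1 triple_Seq_eq[OF t2 triple_Seq_eq[OF t3 t4]]])
  \<comment> \<open>The left side is \<open>526 * (m * N) + 4 * m + 14 * N + 12\<close>, hence at
    most \<open>556 * (m * N)\<close>.\<close>
  moreover have "2 + (2 + (2 + ((2 + (m * (178 * N + 2) + 2)) +
      (14 * N + (m * (348 * N + 2) + 2))))) \<le> 600 * (m * n)"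
  proof -
    have "1 \<le> N" using N by simp
    then have "m * 1 \<le> m * N" "1 * N \<le> m * N" "m * N \<le> m * n"
      using m(1) N(2) by (auto intro: mult_le_mono simp del: mult_1 mult_1_right)
    moreover have "1 \<le> m * N" using m(1) \<open>1 \<le> N\<close> by simp
    moreover have "m * (178 * N + 2) = 178 * (m * N) + 2 * m" "m * (348 * N + 2) = 348 * (m * N) + 2 * m"
      by (simp_all add: algebra_simps)
    ultimately show ?thesis by linarith
  qed
  ultimately show ?thesis by (rule triple_weaken) simp
qed

end

section \<open>The program\<close>

text \<open>Register 0 holds \<open>n\<close>, so every instruction derives the next base address
  from the preceding one. Register 3, the base of array 0, is zero from the start.\<close>

definition base_code :: "nat \<Rightarrow> instr list" where
  "base_code l = map (\<lambda>A. Alu Add (2 * A + 5) (2 * A + 3) 0) [0..<l]"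

text \<open>The input convention delivers \<open>m\<close> in register 1, which serves address
  computations here, so \<open>m\<close> is saved in register 28, that of \<open>V_m\<close>. With
  the twelve base addresses this makes a prologue of 13 instructions.\<close>

definition mappability_program :: program where
  "mappability_program = Move 28 1 # base_code 12 @ comp 13 mappability"

lemma runs_base_code:
  assumes "code_at P (pc s) (base_code l)" "reg s 3 = 0" "reg s 0 = n" "l * n < 2 ^ w"
  shows "\<exists>s'. runs w P b s l s' \<and> pc s' = pc s + l \<and> mem s' = mem s \<and>
    (\<forall>A\<le>l. reg s' (2 * A + 3) = A * n) \<and> (\<forall>x. reg s' (2 * x) = reg s (2 * x))"
  using assms
proof (induction l)
  case 0
  then show ?case using runs_0 by (intro exI[of _ s]) simp
next
  case (Suc l)
  let ?i = "Alu Add (2 * l + 5) (2 * l + 3) 0"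
  have code: "code_at P (pc s) (base_code l)" "code_at P (pc s + l) [?i]"
    using Suc.prems(1) by (simp_all add: base_code_def code_at_append)
  obtain s' where s': "runs w P b s l s'" "pc s' = pc s + l" "mem s' = mem s"
    "\<forall>A\<le>l. reg s' (2 * A + 3) = A * n" "\<forall>x. reg s' (2 * x) = reg s (2 * x)"
    using Suc.IH[OF code(1)] Suc.prems by auto
  let ?s = "exec_instr w ?i s'"
  have "runs w P b s' 1 ?s"
    using code(2) s'(2) by (intro runs_instr) simp_all
  from runs_trans[OF s'(1) this] have "runs w P b s (Suc l) ?s" by simp
  moreover have "reg s' 0 = n" using s'(5)[rule_format, of 0] Suc.prems(3) by simp
  then have "alu w Add (reg s' (2 * l + 3)) (reg s' 0) = Suc l * n"
    using s'(4) Suc.prems(4) by (simp add: add.commute)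
  then have "\<forall>A\<le>Suc l. reg ?s (2 * A + 3) = A * n"
    using s'(4) by (auto simp: le_Suc_eq)
  moreover have "2 * x \<noteq> 2 * l + 5" for x :: nat by presburger
  then have "\<forall>x. reg ?s (2 * x) = reg s (2 * x)" using s'(5) by simp
  ultimately show ?case using s'(2,3) by (intro exI[of _ ?s]) simp
qed

lemma runs_prologue:
  assumes "13 * length x < 2 ^ w"
  defines "P \<equiv> mappability_program"
  shows "\<exists>s. runs w P b (input_config x m) 13 s \<and> pc s = 13 \<and> mem s = mem (input_config x m) \<and>
    (\<forall>A<13. reg s (2 * A + 3) = A * length x) \<and>
    (\<forall>i. reg s (2 * i) = ((\<lambda>_. 0)(V_n := length x, V_m := m)) i)"
proof -
  let ?s = "exec_instr w (Move 28 1) (input_config x m)"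
  have "code_at P 0 mappability_program" unfolding code_at_def P_def by force
  then have code: "code_at P 0 [Move 28 1]" "code_at P 1 (base_code 12)"
    by (auto simp: mappability_program_def code_at_Cons[of _ _ _ "_ @ _"] code_at_append)
  have 1: "runs w P b (input_config x m) 1 ?s"
    by (rule runs_instr) (use code(1) in \<open>simp_all add: input_config_def\<close>)
  have "code_at P (pc ?s) (base_code 12)" "reg ?s 3 = 0" "reg ?s 0 = length x"
    using code(2) by (simp_all add: input_config_def)
  moreover have "12 * length x < 2 ^ w" using assms(1) by linarith
  ultimately obtain s where s: "runs w P b ?s 12 s" "pc s = pc ?s + 12" "mem s = mem ?s"
    "\<forall>A\<le>12. reg s (2 * A + 3) = A * length x" "\<forall>i. reg s (2 * i) = reg ?s (2 * i)"
    using runs_base_code by blast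
  have "reg ?s (2 * i) = ((\<lambda>_. 0)(V_n := length x, V_m := m)) i" for i
    by (auto simp: input_config_def; presburger?)
  moreover have "runs w P b (input_config x m) 13 s" using runs_trans[OF 1 s(1)] by simp
  ultimately show ?thesis using s(2-5) by (intro exI[of _ s]) (auto simp: input_config_def)
qed

theorem theorem2:
  "\<exists>P ct cs cw. cw > 0 \<and>
     (\<forall>(x :: nat list) n m w.
        length x = n \<and> set x \<subseteq> {1..n} \<and> 1 \<le> m \<and> m < n \<and> cw * n < 2 ^ w \<longrightarrow>
        computes_within w P (input_config x m) (ct * (m * n)) (cs * n)
          (output_array n (one_mappability x m)))"
proof (intro exI conjI allI impI)
  show "0 < (13 :: nat)" by simp
next
  fix x :: "nat list" and n m w
  assume A: "length x = n \<and> set x \<subseteq> {1..n} \<and> 1 \<le> m \<and> m < n \<and> 13 * n < 2 ^ w"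
  define y where "y p = x ! p - 1" for p
  let ?N = "n - m + 1"
  have letters: "x ! p = Suc (y p)" "y p < n" if "p < n" for p
  proof -
    have "x ! p \<in> {1..n}" using A that nth_mem by blast
    then show "x ! p = Suc (y p)" "y p < n" by (auto simp: y_def)
  qed
  interpret compiled n 13 w mappability_program using A by unfold_locales simp
  interpret text_positions n "2 ^ w" ?N m y
    using A letters by unfold_locales auto
  define v0 :: "nat \<Rightarrow> nat" where "v0 = (\<lambda>_. 0)(V_n := n, V_m := m)"
  define a0 :: "nat \<Rightarrow> nat \<Rightarrow> nat" where "a0 = (\<lambda>A i. if A = A_text then x ! i else 0)"
  obtain t v a where t: "t \<le> 600 * (m * n)" "big mappability (v0, a0) t (v, a)"
    "\<And>i. i < ?N \<Longrightarrow> a A_result i = card (near ?N y m 0 i)"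
    using triple_mappability[OF v0_def, of a0] letters unfolding triple_def by (auto simp: a0_def)
  obtain s where s: "runs w mappability_program (13 * n) (input_config x m) 13 s" "pc s = 13"
    "mem s = mem (input_config x m)" "\<forall>A<13. reg s (2 * A + 3) = A * n"
    "\<forall>i. reg s (2 * i) = v0 i"
    using runs_prologue[of x w "13 * n" m] A unfolding v0_def by auto
  have "mem s (A * n + i) = a0 A i" if "A < 13" "i < n" for A i
    using that s(3) A by (cases A) (auto simp: a0_def input_config_def)
  then have rep: "represents s (v0, a0)" using s(4,5) by (simp add: represents_def)
  have "code_at mappability_program 13 (comp 13 mappability)"
    unfolding code_at_def mappability_program_def
    by (rule exI[of _ "Move 28 1 # base_code 12"], rule exI[of _ "[]"]) (simp add: base_code_def)
  then obtain k s' where k: "k \<le> t" "runs w mappability_program (13 * n) s k s'"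
    "represents s' (v, a)" "pc s' = 13 + len mappability"
    using comp_correct[OF t(2) rep] s(2) by auto
  have runs: "runs w mappability_program (13 * n) (input_config x m) (13 + k) s'"
    by (rule runs_trans[OF s(1) k(2)])
  have "halted mappability_program s'"
    using k(4) by (simp add: halted_def mappability_program_def base_code_def)
  moreover have "output_array n (one_mappability x m) s'"
    unfolding output_array_def
  proof (intro allI impI)
    fix i assume "i < length (one_mappability x m)"
    then have i: "i < ?N" "i < n" using A by (auto simp: one_mappability_def)
    have "\<forall>A<13. \<forall>i<n. mem s' (A * n + i) = a A i"
      using k(3) by (simp add: represents_def)
    \<comment> \<open>\<open>A_result\<close> is array 1, so its cells start at \<open>n\<close>,
      where the output is expected.\<close>
    from this[rule_format, of 1 i] have "mem s' (1 * n + i) = a 1 i" using i(2) by simp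
    also have "\<dots> = card (near ?N y m 0 i)" using t(3) i(1) by simp
    also have "\<dots> = one_mappability x m ! i"
      using one_mappability_near[of x m i] A i(1) by (simp add: y_def[abs_def])
    finally show "mem s' (n + i) = one_mappability x m ! i" by simp
  qed
  \<comment> \<open>The prologue is absorbed by raising the factor from 600 to 700, as
    \<open>m * n\<close> is at least 1.\<close>
  moreover have "13 + k \<le> 700 * (m * n)"
  proof -
    have "1 \<le> m * n" using A by simp
    then show ?thesis using k(1) t(1) by linarith
  qed
  ultimately show "computes_within w mappability_program (input_config x m) (700 * (m * n))
      (13 * n) (output_array n (one_mappability x m))"
    using runs unfolding computes_within_def runs_def by blast
qed

end
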